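(* Let $a\in\mathbb{C}^{(d+1)\times(k+1)\times r}$ and $Z=[z_1,\dots,z_r]\in\mathbb{C}^{n\times r}$ be the coefficients representing the tensor structured function $\Psi_{k+1}(\theta)=P_d(\theta)\big(\sum_{\ell=1}^r a_{:,:,\ell}\otimes z_\ell\big)$, and suppose that $(\Psi_{k+1},\underline{H}_k)$ is a TIAR factorization. Let $C$ be a constant such that $\|a_{i,:,:}\|\le C/(i-1)!$ for $i=1,\dots,d+1$. Suppose $\{|z|\le R\}\subseteq\Omega$ with $R>1$. Let $A:=[A_1,\dots,A_{d+1}]\in\mathbb{C}^{r\times(d+1)(k+1)}$ be the unfolding of $a$, where $A_i=(a_{i,:,:})^T$. Given the singular value decomposition $$A=[U_1,U]\,\mathrm{diag}(\Sigma_1,\Sigma)\,[V_1^H,\dots,V_{d+1}^H],\quad \Sigma_1=\mathrm{diag}(\sigma_1,\dots,\sigma_{\tilde r}),\quad \Sigma=\mathrm{diag}(\sigma_{\tilde r+1},\dots,\sigma_r),$$ with $\sigma_1\ge\dots\ge\sigma_r\ge 0$, $U_1\in\mathbb{C}^{r\times\tilde r}$, $1\le\tilde r<r$, let $\tilde Z:=ZU_1$ and, for $i=1,\dots,d+1$, let $\tilde A_i:=\Sigma_1 (V_i^H)_{1:\tilde r,:}$, where $(V_i^H)_{1:\tilde r,:}$ denotes the first $\tilde r$ rows of $V_i^H\in\mathbb{C}^{r\times(k+1)}$. Let $\tilde\Psi_{k+1}$ be the tensor structured function defined by the coefficients $\tilde a\in\mathbb{C}^{(d+1)\times(k+1)\times\tilde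 r}$ with $\tilde a_{i,:,:}=\tilde A_i^T$ and $\tilde Z\in\mathbb{C}^{n\times\tilde r}$, i.e. $\tilde\Psi_{k+1}(\theta)=P_d(\theta)\big(\sum_{\ell=1}^{\tilde r}\tilde a_{:,:,\ell}\otimes\tilde z_\ell\big)$, and let $\tilde\Psi_k$ be its first $k$ columns. Then $$\|\Psi_{k+1}-\tilde\Psi_{k+1}\|\le\sqrt{(d+1)(k+1)}\;\sigma_{\tilde r+1},$$ $$\|\mathcal{B}\tilde\Psi_k-\tilde\Psi_{k+1}\underline{H}_k\|\le\sqrt{k}\,(C_d+C_s)\,\sigma_{\tilde r+1},$$ with $$C_d:=\gamma+\log(d+1)+(d+1)\|\underline{H}_k\|,$$ $$C_s:=\|M_0^{-1}\|\Big[(\gamma+\log(s+1))\max_{1\le i\le s}\|M_i\|+\max_{|\lambda|=R}\|M(\lambda)\|\Big],$$ where $\gamma\approx0.57721$ is the Euler--Mascheroni constant and $$s:=\min\Big\{s\in\mathbb{N}:\ \frac{C(d-s)}{R^s}\le\sigma_{\tilde r+1}\Big\}.$$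
   Context: Setting: $\Omega\subseteq\mathbb{C}$ is an open disk centered at the origin, $M:\Omega\to\mathbb{C}^{n\times n}$ is analytic, $M_i:=M^{(i)}(0)$, and $M_0=M(0)$ is invertible (zero is not an eigenvalue). Put $B(\lambda)=M(0)^{-1}(M(0)-M(\lambda))/\lambda$, extended analytically to $\lambda=0$. The linear operator $\mathcal{B}$ acts on analytic functions $\psi:\mathbb{C}\to\mathbb{C}^n$ (for which the series converges) by $$\mathcal{B}\psi(\theta)=\int_0^\theta\psi(\hat\theta)\,d\hat\theta+\sum_{i=0}^\infty\frac{B^{(i)}(0)}{i!}\psi^{(i)}(0),$$ and columnwise on matrix-valued functions. Notation: $P_d(\theta):=(1,\theta,\dots,\theta^d)\otimes I_n\in\mathbb{C}^{n\times(d+1)n}$; $\otimes$ is the Kronecker product; colons denote slices of tensors, so $a_{i,:,:}$ is a $(k+1)\times r$ matrix and $a_{:,:,\ell}$ a $(d+1)\times(k+1)$ matrix; $(\cdot)^T$ is the transpose without conjugation. The columns of $Z$ are orthonormal. $\mathbb{N}=\{1,2,\dots\}$. The singular value decomposition is the economy-size one: $[U_1,U]\in\mathbb{C}^{r\times r}$ is unitary and $[V_1^H,\dots,V_{d+1}^H]\in\mathbb{C}^{r\times(d+1)(k+1)}$ has orthonormal rows. For matrices, $\|\cdot\|$ is the spectral norm. The scalar product of $\psi(\theta)=\sum_i\theta^ix_i$ and $\varphi(\theta)=\sum_i\theta^iy_i$ is $\langle\psi,\varphi\rangle=\sum_i x_i^Hy_i$. For a matrix-valued polynomial $\Psi(\theta)=\sum_i\theta^iX_i$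 the norm is $\|\Psi\|=\big(\sum_i\|X_i\|_F^2\big)^{1/2}$, equivalently $\|P_d(\theta)X\|=\|X\|_F$. TIAR factorization: a pair $(\Psi_{k+1},\underline{H}_k)$ where $\Psi_{k+1}$ is a tensor structured function with $k+1$ columns that are orthonormal in the scalar product above, $\underline{H}_k\in\mathbb{C}^{(k+1)\times k}$ is an upper Hessenberg matrix with positive subdiagonal elements, and $\mathcal{B}\Psi_k(\theta)=\Psi_{k+1}(\theta)\underline{H}_k$, with $\Psi_k$ the first $k$ columns of $\Psi_{k+1}$. *)

theory Defs
  imports
    "HOL-Complex_Analysis.Complex_Analysis"
    "Jordan_Normal_Form.Schur_Decomposition"
begin

unbundle no vec_syntax
no_notation fps_nth (infixl \<open>$\<close> 75)
hide_const (open) Finite_Cartesian_Product.vec Finite_Cartesian_Product.row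
  Finite_Cartesian_Product.column Finite_Cartesian_Product.mat Finite_Cartesian_Product.transpose
hide_type (open) Finite_Cartesian_Product.vec

section \<open>Matrices, norms, slices and blocks\<close>

text \<open>All indices are shifted to start at \<open>0\<close>. Only the values of a tensor inside its index
  ranges matter, since they are only accessed through slices of explicit size.\<close>

type_synonym tensor3 = "nat \<Rightarrow> nat \<Rightarrow> nat \<Rightarrow> complex"

definition vec_norm2 :: "complex vec \<Rightarrow> real" where
  "vec_norm2 v = sqrt (\<Sum>i<dim_vec v. (cmod (v $ i))\<^sup>2)"

text \<open>The unit ball rather than the unit sphere is used so that matrices without columns
  have norm \<open>0\<close>.\<close>

definition spectral_norm :: "complex mat \<Rightarrow> real" where
  "spectral_norm A =
     Sup {vec_norm2 (A *\<^sub>v v) | v. v \<in> carrier_vec (dim_col A) \<and> vec_norm2 v \<le> 1}"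

definition frob_norm :: "complex mat \<Rightarrow> real" where
  "frob_norm A = sqrt (\<Sum>i<dim_row A. \<Sum>j<dim_col A. (cmod (A $$ (i, j)))\<^sup>2)"

definition mat_inv :: "complex mat \<Rightarrow> complex mat" where
  "mat_inv A = the (mat_inverse A)"

definition kron :: "complex mat \<Rightarrow> complex mat \<Rightarrow> complex mat" where
  "kron A B = mat (dim_row A * dim_row B) (dim_col A * dim_col B)
     (\<lambda>(i, j). A $$ (i div dim_row B, j div dim_col B) * B $$ (i mod dim_row B, j mod dim_col B))"

definition first_cols :: "nat \<Rightarrow> complex mat \<Rightarrow> complex mat" where
  "first_cols m A = mat (dim_row A) m (\<lambda>(i, j). A $$ (i, j))"

definition first_rows :: "nat \<Rightarrow> complex mat \<Rightarrow> complex mat" where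
  "first_rows m A = mat m (dim_col A) (\<lambda>(i, j). A $$ (i, j))"

definition hblocks :: "nat \<Rightarrow> complex mat list \<Rightarrow> complex mat" where
  "hblocks p As = mat_of_cols p (concat (map cols As))"

definition orthonormal_cols :: "complex mat \<Rightarrow> bool" where
  "orthonormal_cols A \<longleftrightarrow> mat_adjoint A * A = 1\<^sub>m (dim_col A)"

definition orthonormal_rows :: "complex mat \<Rightarrow> bool" where
  "orthonormal_rows A \<longleftrightarrow> A * mat_adjoint A = 1\<^sub>m (dim_row A)"

definition unitary_mat :: "complex mat \<Rightarrow> bool" where
  "unitary_mat A \<longleftrightarrow> square_mat A \<and> orthonormal_cols A \<and> orthonormal_rows A"

text \<open>\<open>slice1 m r a i\<close> is \<open>a(i,:,:)\<close> of size \<open>m \<times> r\<close>, and \<open>slice3 p m a l\<close> is \<open>a(:,:,l)\<close> of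
  size \<open>p \<times> m\<close>.\<close>

definition slice1 :: "nat \<Rightarrow> nat \<Rightarrow> tensor3 \<Rightarrow> nat \<Rightarrow> complex mat" where
  "slice1 m r a i = mat m r (\<lambda>(j, l). a i j l)"

definition slice3 :: "nat \<Rightarrow> nat \<Rightarrow> tensor3 \<Rightarrow> nat \<Rightarrow> complex mat" where
  "slice3 p m a l = mat p m (\<lambda>(i, j). a i j l)"


section \<open>Derivatives, polynomial scalar product and norm\<close>

definition vec_deriv :: "nat \<Rightarrow> (complex \<Rightarrow> complex vec) \<Rightarrow> complex \<Rightarrow> complex vec" where
  "vec_deriv i \<psi> z = vec (dim_vec (\<psi> z)) (\<lambda>p. (deriv ^^ i) (\<lambda>w. \<psi> w $ p) z)"

definition mat_deriv :: "nat \<Rightarrow> (complex \<Rightarrow> complex mat) \<Rightarrow> complex \<Rightarrow> complex mat" where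
  "mat_deriv i \<Psi> z = mat (dim_row (\<Psi> z)) (dim_col (\<Psi> z))
     (\<lambda>(p, q). (deriv ^^ i) (\<lambda>w. \<Psi> w $$ (p, q)) z)"

text \<open>The coefficients of a polynomial function are recovered as its Taylor coefficients at
  \<open>0\<close>; the series below are then finite sums (see \<open>poly_scalar_eq\<close> and \<open>poly_norm_eq\<close>).\<close>

definition poly_scalar ::
    "(complex \<Rightarrow> complex vec) \<Rightarrow> (complex \<Rightarrow> complex vec) \<Rightarrow> complex" where
  "poly_scalar \<psi> \<phi> =
     (\<Sum>i. ((1 / fact i) \<cdot>\<^sub>v vec_deriv i \<phi> 0) \<bullet>c ((1 / fact i) \<cdot>\<^sub>v vec_deriv i \<psi> 0))"

definition poly_norm :: "(complex \<Rightarrow> complex mat) \<Rightarrow> real" where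
  "poly_norm \<Psi> = sqrt (\<Sum>i. (frob_norm ((1 / fact i) \<cdot>\<^sub>m mat_deriv i \<Psi> 0))\<^sup>2)"

lemma higher_deriv_poly:
  "(deriv ^^ i) (poly p) = poly ((pderiv ^^ i) p)" for p :: "complex poly"
proof (induction i)
  case (Suc i)
  have "deriv (poly q) = poly (pderiv q)" for q :: "complex poly"
    by (rule ext) (rule DERIV_imp_deriv[OF poly_DERIV])
  then show ?case using Suc by simp
qed auto

lemma taylor_coeff_poly:
  fixes c :: "nat \<Rightarrow> complex"
  assumes "\<And>z. f z = (\<Sum>i\<le>N. z ^ i * c i)"
  shows "1 / fact i * (deriv ^^ i) f 0 = (if i \<le> N then c i else 0)"
proof -
  define p where "p = (\<Sum>i\<le>N. monom (c i) i)"
  have f: "f = poly p"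
    by (rule ext) (simp add: assms p_def poly_sum poly_monom mult.commute)
  have "(deriv ^^ i) f 0 = coeff ((pderiv ^^ i) p) 0"
    unfolding f higher_deriv_poly by (simp add: poly_0_coeff_0)
  also have "\<dots> = fact i * coeff p i"
    by (simp add: coeff_higher_pderiv pochhammer_fact)
  also have "coeff p i = (if i \<le> N then c i else 0)"
    by (simp add: p_def coeff_sum if_distrib sum.delta cong: if_cong)
  finally show ?thesis by simp
qed

lemma poly_norm_eq:
  assumes \<Psi>: "\<And>z. \<Psi> z = mat p q (\<lambda>(u, v). \<Sum>i\<le>N. z ^ i * X i $$ (u, v))"
    and X: "\<And>i. i \<le> N \<Longrightarrow> X i \<in> carrier_mat p q"
  shows "poly_norm \<Psi> = sqrt (\<Sum>i\<le>N. (frob_norm (X i))\<^sup>2)"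
proof -
  have e: "1 / fact i * (deriv ^^ i) (\<lambda>w. \<Psi> w $$ (u, v)) 0 = (if i \<le> N then X i $$ (u, v) else 0)"
    if "u < p" "v < q" for i u v
    by (rule taylor_coeff_poly) (simp add: \<Psi> that)
  have Xd: "dim_row (X i) = p" "dim_col (X i) = q" if "i \<le> N" for i
    using X[OF that] by auto
  have c: "(1 / fact i) \<cdot>\<^sub>m mat_deriv i \<Psi> 0 = (if i \<le> N then X i else 0\<^sub>m p q)" for i
  proof (rule eq_matI)
    have d: "dim_row (\<Psi> 0) = p" "dim_col (\<Psi> 0) = q" by (simp_all add: \<Psi>)
    show "dim_row ((1 / fact i) \<cdot>\<^sub>m mat_deriv i \<Psi> 0) = dim_row (if i \<le> N then X i else 0\<^sub>m p q)"
      by (cases "i \<le> N") (simp_all add: mat_deriv_def d Xd)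
    show "dim_col ((1 / fact i) \<cdot>\<^sub>m mat_deriv i \<Psi> 0) = dim_col (if i \<le> N then X i else 0\<^sub>m p q)"
      by (cases "i \<le> N") (simp_all add: mat_deriv_def d Xd)
    fix u v
    assume "u < dim_row (if i \<le> N then X i else 0\<^sub>m p q)" "v < dim_col (if i \<le> N then X i else 0\<^sub>m p q)"
    then have uv: "u < p" "v < q" by (auto simp: Xd split: if_splits)
    show "((1 / fact i) \<cdot>\<^sub>m mat_deriv i \<Psi> 0) $$ (u, v) = (if i \<le> N then X i else 0\<^sub>m p q) $$ (u, v)"
      using e[OF uv, of i] uv d by (auto simp: mat_deriv_def)
  qed
  have "(\<Sum>i. (frob_norm ((1 / fact i) \<cdot>\<^sub>m mat_deriv i \<Psi> 0))\<^sup>2) =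
      (\<Sum>i\<le>N. (frob_norm ((1 / fact i) \<cdot>\<^sub>m mat_deriv i \<Psi> 0))\<^sup>2)"
    by (rule suminf_finite) (auto simp: c frob_norm_def)
  then show ?thesis by (simp add: poly_norm_def c)
qed

lemma poly_scalar_eq:
  assumes \<psi>: "\<And>z. \<psi> z = vec n (\<lambda>p. \<Sum>i\<le>N. z ^ i * x i $ p)"
    and \<phi>: "\<And>z. \<phi> z = vec n (\<lambda>p. \<Sum>i\<le>N. z ^ i * y i $ p)"
  shows "poly_scalar \<psi> \<phi> = (\<Sum>i\<le>N. \<Sum>p<n. cnj (x i $ p) * y i $ p)"
proof -
  have c: "(1 / fact i) \<cdot>\<^sub>v vec_deriv i f 0 = vec n (\<lambda>p. if i \<le> N then w i $ p else 0)"
    if f: "\<And>z. f z = vec n (\<lambda>p. \<Sum>i\<le>N. z ^ i * w i $ p)" for f and w :: "nat \<Rightarrow> complex vec" and i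
  proof (rule eq_vecI)
    show "dim_vec ((1 / fact i) \<cdot>\<^sub>v vec_deriv i f 0) = dim_vec (vec n (\<lambda>p. if i \<le> N then w i $ p else 0))"
      by (simp add: vec_deriv_def f)
    fix p assume "p < dim_vec (vec n (\<lambda>p. if i \<le> N then w i $ p else 0))"
    then have p: "p < n" by simp
    have "1 / fact i * (deriv ^^ i) (\<lambda>z. f z $ p) 0 = (if i \<le> N then w i $ p else 0)"
      by (rule taylor_coeff_poly) (simp add: f p)
    then show "((1 / fact i) \<cdot>\<^sub>v vec_deriv i f 0) $ p = vec n (\<lambda>p. if i \<le> N then w i $ p else 0) $ p"
      using p by (simp add: vec_deriv_def f)
  qed
  have "poly_scalar \<psi> \<phi> = (\<Sum>i\<le>N. vec n (\<lambda>p. if i \<le> N then y i $ p else 0) \<bullet>c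
      vec n (\<lambda>p. if i \<le> N then x i $ p else 0))"
    unfolding poly_scalar_def c[OF \<psi>] c[OF \<phi>]
    by (rule suminf_finite) (auto simp: scalar_prod_def)
  also have "\<dots> = (\<Sum>i\<le>N. \<Sum>p<n. cnj (x i $ p) * y i $ p)"
    by (intro sum.cong refl) (auto simp: scalar_prod_def atLeast0LessThan mult.commute)
  finally show ?thesis .
qed


section \<open>The operator associated with the nonlinear eigenvalue problem\<close>

definition B_quot :: "(complex \<Rightarrow> complex mat) \<Rightarrow> complex \<Rightarrow> complex mat" where
  "B_quot M \<mu> = (1 / \<mu>) \<cdot>\<^sub>m (mat_inv (M 0) * (M 0 - M \<mu>))"

text \<open>The value at \<open>0\<close> is the limit removing the singularity of the quotient. Away from the
  domain of \<open>M\<close> the values are irrelevant: only derivatives at \<open>0\<close> are used.\<close>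

definition B_fun :: "(complex \<Rightarrow> complex mat) \<Rightarrow> complex \<Rightarrow> complex mat" where
  "B_fun M \<mu> = (if \<mu> = 0
     then mat (dim_row (M 0)) (dim_col (M 0)) (\<lambda>(p, q). Lim (at 0) (\<lambda>z. B_quot M z $$ (p, q)))
     else B_quot M \<mu>)"

definition op_B_vec ::
    "(complex \<Rightarrow> complex mat) \<Rightarrow> (complex \<Rightarrow> complex vec) \<Rightarrow> complex \<Rightarrow> complex vec" where
  "op_B_vec M \<psi> \<theta> =
     vec (dim_vec (\<psi> 0)) (\<lambda>p. contour_integral (linepath 0 \<theta>) (\<lambda>t. \<psi> t $ p)) +
     vec (dim_row (M 0))
       (\<lambda>p. \<Sum>i. (((1 / fact i) \<cdot>\<^sub>m mat_deriv i (B_fun M) 0) *\<^sub>v vec_deriv i \<psi> 0) $ p)"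

definition op_B ::
    "(complex \<Rightarrow> complex mat) \<Rightarrow> (complex \<Rightarrow> complex mat) \<Rightarrow> complex \<Rightarrow> complex mat" where
  "op_B M \<Psi> \<theta> = mat_of_cols (dim_row (M 0))
     (map (\<lambda>j. op_B_vec M (\<lambda>t. col (\<Psi> t) j) \<theta>) [0..<dim_col (\<Psi> 0)])"


section \<open>Tensor structured functions and TIAR factorizations\<close>

definition P_mat :: "nat \<Rightarrow> nat \<Rightarrow> complex \<Rightarrow> complex mat" where
  "P_mat n d \<theta> = kron (mat 1 (d + 1) (\<lambda>(_, j). \<theta> ^ j)) (1\<^sub>m n)"

text \<open>The tensor structured function with \<open>m\<close> columns given by \<open>a\<close>, of size
  \<open>(d + 1) \<times> m \<times> dim_col Z\<close>, and \<open>Z\<close>. The matrix sum is written entrywise.\<close>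

definition tensor_fun :: "nat \<Rightarrow> nat \<Rightarrow> tensor3 \<Rightarrow> complex mat \<Rightarrow> complex \<Rightarrow> complex mat" where
  "tensor_fun d m a Z \<theta> = P_mat (dim_row Z) d \<theta> *
     mat ((d + 1) * dim_row Z) m (\<lambda>(p, q). \<Sum>l<dim_col Z.
       kron (slice3 (d + 1) m a l) (mat_of_cols (dim_row Z) [col Z l]) $$ (p, q))"

definition tensor_structured :: "nat \<Rightarrow> nat \<Rightarrow> (complex \<Rightarrow> complex mat) \<Rightarrow> bool" where
  "tensor_structured n m \<Psi> \<longleftrightarrow>
     (\<exists>d r a Z. Z \<in> carrier_mat n r \<and> orthonormal_cols Z \<and> \<Psi> = tensor_fun d m a Z)"

definition upper_hessenberg :: "complex mat \<Rightarrow> bool" where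
  "upper_hessenberg H \<longleftrightarrow> (\<forall>i<dim_row H. \<forall>j<dim_col H. j + 1 < i \<longrightarrow> H $$ (i, j) = 0)"

definition tiar_factorization ::
    "(complex \<Rightarrow> complex mat) \<Rightarrow> nat \<Rightarrow> (complex \<Rightarrow> complex mat) \<Rightarrow> complex mat \<Rightarrow> bool" where
  "tiar_factorization M k \<Psi> H \<longleftrightarrow>
     tensor_structured (dim_row (M 0)) (k + 1) \<Psi> \<and>
     (\<forall>i<k + 1. \<forall>j<k + 1.
        poly_scalar (\<lambda>\<theta>. col (\<Psi> \<theta>) i) (\<lambda>\<theta>. col (\<Psi> \<theta>) j) = (if i = j then 1 else 0)) \<and>
     H \<in> carrier_mat (k + 1) k \<and> upper_hessenberg H \<and>
     (\<forall>j<k. \<exists>x::real. x > 0 \<and> H $$ (j + 1, j) = complex_of_real x) \<and>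
     (\<forall>\<theta>. op_B M (\<lambda>t. first_cols k (\<Psi> t)) \<theta> = \<Psi> \<theta> * H)"

end

theory Submission
  imports Defs
begin

text \<open>
  Write \<open>\<Psi>(\<theta>) = \<Sum>\<^sub>i \<theta>\<^sup>i Z A\<^sub>i\<close>. Truncating the singular value decomposition removes from each
  block \<open>A\<^sub>i\<close> a matrix \<open>N\<^sub>i\<close>, and the error is \<open>\<Delta>(\<theta>) = \<Psi>(\<theta>) - \<Psi>'(\<theta>) = \<Sum>\<^sub>i \<theta>\<^sup>i D\<^sub>i\<close> with
  \<open>D\<^sub>i = Z N\<^sub>i\<close>. As \<open>Z\<close> and \<open>[U\<^sub>1, U]\<close> are isometries and the blocks of a matrix with
  orthonormal rows are contractions, \<open>D\<^sub>i\<close> has norm at most \<open>\<sigma> r1\<close>, the first discarded singular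
  value, and each of its columns is no longer than the same column of \<open>A\<^sub>i\<close>, so at most
  \<open>C / i!\<close> long (\<open>truncated_svd_block\<close>). The first claim follows by counting the
  \<open>(d + 1) (k + 1)\<close> columns.

  The residual \<open>B \<Psi>'\<^sub>k - \<Psi>' H\<close> is linear in the function and vanishes for \<open>\<Psi>\<close>, hence equals
  \<open>\<Delta> H - B \<Delta>\<^sub>k\<close> (\<open>residual_eq_mat_poly\<close>). It is estimated column by column, the \<open>k\<close> columns
  giving the factor \<open>sqrt k\<close>. Three contributions arise. First, \<open>\<Delta> H\<close> costs \<open>\<sigma> r1 \<parallel>H\<parallel>\<close> in each of
  \<open>d + 1\<close> degrees. Second, integration divides the coefficient of degree \<open>i\<close> by \<open>i + 1\<close>. Comparing the
  terms of degree \<open>d + 1\<close> in \<open>B \<Psi>\<^sub>k = \<Psi> H\<close> shows that \<open>\<Psi>\<^sub>k\<close>, and with it \<open>\<Delta>\<^sub>k\<close>, has no term of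
  degree \<open>d\<close> (\<open>top_coeff_zero\<close>), so that the sum of these factors is the harmonic number
  \<open>harm d \<le> \<gamma> + ln (d + 1)\<close>. These two contributions form \<open>C_d\<close>.

  Third, since \<open>B\<^sup>(\<^sup>i\<^sup>)(0) = - M\<^sub>0\<^sup>-\<^sup>1 M\<^sub>i\<^sub>+\<^sub>1 / (i + 1)\<close> (\<open>mat_deriv_B_fun\<close>), the constant term of
  \<open>B \<Delta>\<^sub>k\<close> is a sum of \<open>- M\<^sub>0\<^sup>-\<^sup>1 M\<^sub>i\<^sub>+\<^sub>1 D\<^sub>i / (i + 1)\<close> over \<open>i < d\<close>. For \<open>i < s\<close> the bound \<open>\<sigma> r1\<close> is used and leads
  to another harmonic number. For \<open>i \<ge> s\<close> Cauchy's inequality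
  \<open>\<parallel>M\<^sub>j\<parallel> \<le> j! S / R\<^sup>j\<close>, with \<open>S\<close> the maximum of \<open>\<parallel>M\<parallel>\<close> on the circle, meets the bound \<open>C / i!\<close>: the
  factorials cancel and each of the \<open>d - s\<close> remaining terms is at most \<open>S C / R\<^sup>s\<close>. By the choice of
  \<open>s\<close> they add up to at most \<open>S \<sigma> r1\<close> (\<open>weighted_sum_split_le\<close>). This contribution is \<open>C_s\<close>.
\<close>

section \<open>Euclidean norm and spectral norm\<close>

lemma vec_norm2_L2_set: "vec_norm2 v = L2_set (\<lambda>i. cmod (v $ i)) {..<dim_vec v}"
  by (simp add: vec_norm2_def L2_set_def)

lemma vec_norm2_nonneg [simp]: "0 \<le> vec_norm2 v"
  by (simp add: vec_norm2_L2_set)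

lemma vec_norm2_sq: "(vec_norm2 v)\<^sup>2 = (\<Sum>i<dim_vec v. (cmod (v $ i))\<^sup>2)"
  by (simp add: vec_norm2_def sum_nonneg)

lemma cmod_index_le_vec_norm2:
  assumes "i < dim_vec v"
  shows "cmod (v $ i) \<le> vec_norm2 v"
  unfolding vec_norm2_L2_set using assms by (intro member_le_L2_set) auto

lemma vec_norm2_mono:
  assumes "dim_vec v = dim_vec w" "\<And>i. i < dim_vec w \<Longrightarrow> cmod (v $ i) \<le> cmod (w $ i)"
  shows "vec_norm2 v \<le> vec_norm2 w"
  unfolding vec_norm2_L2_set assms(1) using assms(2) by (intro L2_set_mono) auto

lemma vec_norm2_smult: "vec_norm2 (c \<cdot>\<^sub>v v) = cmod c * vec_norm2 v"
  unfolding vec_norm2_L2_set L2_set_right_distrib[OF norm_ge_zero]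
  by (intro L2_set_cong) (auto simp: norm_mult)

lemma vec_norm2_zero [simp]: "vec_norm2 (0\<^sub>v m) = 0"
  by (simp add: vec_norm2_def)

lemma vec_norm2_eq_0D:
  assumes "vec_norm2 v = 0"
  shows "v = 0\<^sub>v (dim_vec v)"
proof (rule eq_vecI)
  fix i assume i: "i < dim_vec (0\<^sub>v (dim_vec v) :: complex vec)"
  have "cmod (v $ i) \<le> 0"
    using cmod_index_le_vec_norm2[of i v] i assms by simp
  with i show "v $ i = 0\<^sub>v (dim_vec v) $ i" by simp
qed simp

lemma vec_norm2_add_le:
  assumes "v \<in> carrier_vec m" "w \<in> carrier_vec m"
  shows "vec_norm2 (v + w) \<le> vec_norm2 v + vec_norm2 w"
proof -
  have d: "dim_vec v = m" "dim_vec w = m" using assms by auto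
  have "vec_norm2 (v + w) \<le> L2_set (\<lambda>i. cmod (v $ i) + cmod (w $ i)) {..<m}"
    unfolding vec_norm2_L2_set by (simp add: d) (intro L2_set_mono, auto simp: norm_triangle_ineq d)
  also have "\<dots> \<le> vec_norm2 v + vec_norm2 w"
    unfolding vec_norm2_L2_set d by (rule L2_set_triangle_ineq)
  finally show ?thesis .
qed

lemma vec_norm2_diff_le:
  assumes "v \<in> carrier_vec m" "w \<in> carrier_vec m"
  shows "vec_norm2 (v - w) \<le> vec_norm2 v + vec_norm2 w"
proof -
  have "v - w = v + (-1) \<cdot>\<^sub>v w" using assms by auto
  then show ?thesis
    using vec_norm2_add_le[of v m "(-1) \<cdot>\<^sub>v w"] assms by (simp add: vec_norm2_smult)
qed

lemma vec_norm2_sum_le: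
  fixes f :: "'i \<Rightarrow> nat \<Rightarrow> complex"
  assumes "finite I"
  shows "vec_norm2 (vec m (\<lambda>p. \<Sum>i\<in>I. f i p)) \<le> (\<Sum>i\<in>I. vec_norm2 (vec m (f i)))"
  using assms
proof induction
  case empty
  have "vec m (\<lambda>p. \<Sum>i\<in>{}. f i p) = 0\<^sub>v m" by auto
  then show ?case by simp
next
  case (insert j I)
  have "vec m (\<lambda>p. \<Sum>i\<in>insert j I. f i p) = vec m (f j) + vec m (\<lambda>p. \<Sum>i\<in>I. f i p)"
    using insert by auto
  then show ?case
    using insert vec_norm2_add_le[of "vec m (f j)" m "vec m (\<lambda>p. \<Sum>i\<in>I. f i p)"] by simp
qed

lemma of_real_vec_norm2_sq: "complex_of_real ((vec_norm2 v)\<^sup>2) = v \<bullet>c v"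
  unfolding vec_norm2_sq scalar_prod_def of_real_sum
  by (intro sum.cong)
     (auto simp: atLeast0LessThan simp flip: complex_norm_square)

lemma cmod_scalar_prod_le:
  assumes "v \<in> carrier_vec m" "w \<in> carrier_vec m"
  shows "cmod (v \<bullet>c w) \<le> vec_norm2 v * vec_norm2 w"
proof -
  have d: "dim_vec v = m" "dim_vec w = m" using assms by auto
  have "cmod (v \<bullet>c w) \<le> (\<Sum>i<m. cmod (v $ i * cnj (w $ i)))"
    by (simp add: scalar_prod_def d atLeast0LessThan) (rule norm_sum)
  also have "\<dots> \<le> vec_norm2 v * vec_norm2 w"
    unfolding vec_norm2_L2_set d
    using L2_set_mult_ineq[of "\<lambda>i. cmod (v $ i)" "\<lambda>i. cmod (w $ i)" "{..<m}"]
    by (simp add: norm_mult)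
  finally show ?thesis .
qed

lemma mat_adjoint_dim [simp]:
  "dim_row (mat_adjoint A) = dim_col A" "dim_col (mat_adjoint A) = dim_row A"
  by (simp_all add: mat_adjoint_def)

lemma mat_adjoint_carrier [intro]: "A \<in> carrier_mat p q \<Longrightarrow> mat_adjoint A \<in> carrier_mat q p"
  by auto

lemma mat_adjoint_index [simp]:
  "i < dim_col A \<Longrightarrow> j < dim_row A \<Longrightarrow> mat_adjoint A $$ (i, j) = cnj (A $$ (j, i))"
  for A :: "complex mat"
  by (simp add: mat_adjoint_def mat_of_rows_index)

lemma mat_adjoint_adjoint [simp]: "mat_adjoint (mat_adjoint A) = A" for A :: "complex mat"
  by (rule eq_matI) simp_all

lemma mult_mat_vec_index:
  assumes "A \<in> carrier_mat p q" "v \<in> carrier_vec q" "i < p"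
  shows "(A *\<^sub>v v) $ i = (\<Sum>j<q. A $$ (i, j) * v $ j)"
  using assms by (auto simp: scalar_prod_def atLeast0LessThan)

lemma mult_mat_index:
  assumes "A \<in> carrier_mat p q" "B \<in> carrier_mat q t" "i < p" "j < t"
  shows "(A * B) $$ (i, j) = (\<Sum>l<q. A $$ (i, l) * B $$ (l, j))"
  using assms by (auto simp: scalar_prod_def atLeast0LessThan)

lemma vec_norm2_unit_vec [simp]: "j < m \<Longrightarrow> vec_norm2 (unit_vec m j) = 1"
  by (simp add: vec_norm2_def unit_vec_def if_distrib[of "\<lambda>x. (cmod x)\<^sup>2"] cong: if_cong)

lemma mult_mat_unit_vec:
  fixes A :: "complex mat"
  assumes "A \<in> carrier_mat p q" "j < q"
  shows "A *\<^sub>v unit_vec q j = col A j"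
  using assms by (intro eq_vecI) auto

lemma smult_mat_mult_vec:
  fixes A :: "complex mat"
  assumes A: "A \<in> carrier_mat p q" and v: "v \<in> carrier_vec q"
  shows "(c \<cdot>\<^sub>m A) *\<^sub>v v = c \<cdot>\<^sub>v (A *\<^sub>v v)"
proof (rule eq_vecI)
  fix i assume "i < dim_vec (c \<cdot>\<^sub>v (A *\<^sub>v v))"
  then have i: "i < p" using A by simp
  then show "((c \<cdot>\<^sub>m A) *\<^sub>v v) $ i = (c \<cdot>\<^sub>v (A *\<^sub>v v)) $ i"
    using A mult_mat_vec_index[OF A v i] mult_mat_vec_index[OF smult_carrier_mat[OF A] v i, of c]
    by (simp add: sum_distrib_left mult.assoc del: index_mult_mat_vec)
qed (use A in simp)

lemma scalar_prod_adjoint: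
  fixes A :: "complex mat"
  assumes A: "A \<in> carrier_mat p q" and v: "v \<in> carrier_vec q" and w: "w \<in> carrier_vec p"
  shows "(A *\<^sub>v v) \<bullet>c w = v \<bullet>c (mat_adjoint A *\<^sub>v w)"
proof -
  have "(A *\<^sub>v v) \<bullet>c w = (\<Sum>i<p. (\<Sum>j<q. A $$ (i, j) * v $ j) * cnj (w $ i))"
    unfolding scalar_prod_def using A v w
    by (auto simp: atLeast0LessThan mult_mat_vec_index[OF A v] simp del: index_mult_mat_vec)
  also have "\<dots> = (\<Sum>j<q. v $ j * (\<Sum>i<p. A $$ (i, j) * cnj (w $ i)))"
    by (simp add: sum_distrib_left sum_distrib_right mult_ac) (rule sum.swap)
  also have "\<dots> = (\<Sum>j<q. v $ j * cnj ((mat_adjoint A *\<^sub>v w) $ j))"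
    using A w by (intro sum.cong)
      (auto simp: mult_mat_vec_index[OF mat_adjoint_carrier[OF A] w] simp del: index_mult_mat_vec)
  also have "\<dots> = v \<bullet>c (mat_adjoint A *\<^sub>v w)"
    unfolding scalar_prod_def using A v w by (auto simp: atLeast0LessThan)
  finally show ?thesis .
qed

lemma vec_norm2_isometry:
  assumes A: "A \<in> carrier_mat p q" and o: "orthonormal_cols A" and v: "v \<in> carrier_vec q"
  shows "vec_norm2 (A *\<^sub>v v) = vec_norm2 v"
proof -
  have Av: "A *\<^sub>v v \<in> carrier_vec p" using A v by auto
  have "complex_of_real ((vec_norm2 (A *\<^sub>v v))\<^sup>2) = v \<bullet>c (mat_adjoint A *\<^sub>v (A *\<^sub>v v))"
    unfolding of_real_vec_norm2_sq by (rule scalar_prod_adjoint[OF A v Av])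
  also have "mat_adjoint A *\<^sub>v (A *\<^sub>v v) = (mat_adjoint A * A) *\<^sub>v v"
    using A v by (intro assoc_mult_mat_vec[symmetric]) auto
  also have "\<dots> = v"
    using o A v unfolding orthonormal_cols_def by auto
  also have "v \<bullet>c v = complex_of_real ((vec_norm2 v)\<^sup>2)"
    by (simp only: of_real_vec_norm2_sq)
  finally have "(vec_norm2 (A *\<^sub>v v))\<^sup>2 = (vec_norm2 v)\<^sup>2"
    by (simp only: of_real_eq_iff)
  then show ?thesis by simp
qed

text \<open>Orthonormal rows make the adjoint an isometry, and a matrix contracts as soon as its adjoint
  does, by Cauchy--Schwarz: \<open>\<parallel>A v\<parallel>\<^sup>2 = \<langle>v, A\<^sup>H A v\<rangle> \<le> \<parallel>v\<parallel> \<parallel>A v\<parallel>\<close>.\<close>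

lemma vec_norm2_orthonormal_rows_le:
  assumes A: "A \<in> carrier_mat p q" and o: "orthonormal_rows A" and v: "v \<in> carrier_vec q"
  shows "vec_norm2 (A *\<^sub>v v) \<le> vec_norm2 v"
proof -
  have Av: "A *\<^sub>v v \<in> carrier_vec p" using A v by auto
  have o': "orthonormal_cols (mat_adjoint A)"
    using o by (simp add: orthonormal_cols_def orthonormal_rows_def)
  have "(vec_norm2 (A *\<^sub>v v))\<^sup>2 = cmod ((A *\<^sub>v v) \<bullet>c (A *\<^sub>v v))"
    unfolding of_real_vec_norm2_sq[symmetric] norm_of_real by simp
  also have "\<dots> = cmod (v \<bullet>c (mat_adjoint A *\<^sub>v (A *\<^sub>v v)))"
    by (simp only: scalar_prod_adjoint[OF A v Av])
  also have "\<dots> \<le> vec_norm2 v * vec_norm2 (mat_adjoint A *\<^sub>v (A *\<^sub>v v))"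
    using A v Av by (intro cmod_scalar_prod_le[of _ q] mult_mat_vec_carrier[of _ q p]) auto
  also have "vec_norm2 (mat_adjoint A *\<^sub>v (A *\<^sub>v v)) = vec_norm2 (A *\<^sub>v v)"
    by (rule vec_norm2_isometry[OF mat_adjoint_carrier[OF A] o' Av])
  finally have "vec_norm2 (A *\<^sub>v v) * vec_norm2 (A *\<^sub>v v) \<le> vec_norm2 v * vec_norm2 (A *\<^sub>v v)"
    by (simp add: power2_eq_square)
  then show ?thesis
    using vec_norm2_nonneg[of "A *\<^sub>v v"] vec_norm2_nonneg[of v]
    by (metis less_le mult_le_cancel_right_pos)
qed

lemma frob_norm_sq: "(frob_norm A)\<^sup>2 = (\<Sum>j<dim_col A. (vec_norm2 (col A j))\<^sup>2)"
proof -
  have "(frob_norm A)\<^sup>2 = (\<Sum>i<dim_row A. \<Sum>j<dim_col A. (cmod (A $$ (i, j)))\<^sup>2)"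
    by (simp add: frob_norm_def sum_nonneg)
  also have "\<dots> = (\<Sum>j<dim_col A. \<Sum>i<dim_row A. (cmod (A $$ (i, j)))\<^sup>2)"
    by (rule sum.swap)
  finally show ?thesis by (simp add: vec_norm2_sq)
qed

lemma vec_norm2_mult_le_sum_cols:
  assumes A: "A \<in> carrier_mat p q" and v: "v \<in> carrier_vec q"
  shows "vec_norm2 (A *\<^sub>v v) \<le> (\<Sum>j<q. vec_norm2 (col A j)) * vec_norm2 v"
proof -
  have e: "A *\<^sub>v v = vec p (\<lambda>i. \<Sum>j<q. A $$ (i, j) * v $ j)"
    using A v by (intro eq_vecI) (auto simp: mult_mat_vec_index[OF A v] simp del: index_mult_mat_vec)
  have "vec_norm2 (A *\<^sub>v v) \<le> (\<Sum>j<q. vec_norm2 (vec p (\<lambda>i. A $$ (i, j) * v $ j)))"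
    unfolding e by (rule vec_norm2_sum_le) simp
  also have "\<dots> \<le> (\<Sum>j<q. vec_norm2 (col A j) * vec_norm2 v)"
  proof (rule sum_mono)
    fix j assume j: "j \<in> {..<q}"
    have "vec p (\<lambda>i. A $$ (i, j) * v $ j) = v $ j \<cdot>\<^sub>v col A j"
      using A j by (intro eq_vecI) auto
    then have "vec_norm2 (vec p (\<lambda>i. A $$ (i, j) * v $ j)) = cmod (v $ j) * vec_norm2 (col A j)"
      by (simp add: vec_norm2_smult)
    also have "\<dots> \<le> vec_norm2 v * vec_norm2 (col A j)"
      using j v by (intro mult_right_mono cmod_index_le_vec_norm2) auto
    finally show "vec_norm2 (vec p (\<lambda>i. A $$ (i, j) * v $ j)) \<le> vec_norm2 (col A j) * vec_norm2 v"
      by (simp add: mult.commute)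
  qed
  finally show ?thesis by (simp add: sum_distrib_right)
qed

lemma bdd_above_spectral_norm:
  "bdd_above {vec_norm2 (A *\<^sub>v v) | v. v \<in> carrier_vec (dim_col A) \<and> vec_norm2 v \<le> 1}"
proof (rule bdd_aboveI, clarify)
  fix v assume v: "v \<in> carrier_vec (dim_col A)" and "vec_norm2 v \<le> 1"
  then show "vec_norm2 (A *\<^sub>v v) \<le> (\<Sum>j<dim_col A. vec_norm2 (col A j)) * 1"
    by (intro order_trans[OF vec_norm2_mult_le_sum_cols[of A "dim_row A" "dim_col A"]]
        mult_left_mono sum_nonneg) auto
qed

lemma spectral_norm_upper:
  assumes "v \<in> carrier_vec (dim_col A)" "vec_norm2 v \<le> 1"
  shows "vec_norm2 (A *\<^sub>v v) \<le> spectral_norm A"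
  unfolding spectral_norm_def using assms by (intro cSup_upper bdd_above_spectral_norm) auto

lemma spectral_norm_nonneg: "0 \<le> spectral_norm A"
  by (rule order_trans[OF vec_norm2_nonneg spectral_norm_upper[of "0\<^sub>v (dim_col A)"]]) simp_all

lemma spectral_norm_le:
  assumes "\<And>v. v \<in> carrier_vec (dim_col A) \<Longrightarrow> vec_norm2 v \<le> 1 \<Longrightarrow> vec_norm2 (A *\<^sub>v v) \<le> c"
  shows "spectral_norm A \<le> c"
  unfolding spectral_norm_def
proof (rule cSup_least)
  show "{vec_norm2 (A *\<^sub>v v) | v. v \<in> carrier_vec (dim_col A) \<and> vec_norm2 v \<le> 1} \<noteq> {}"
    by (auto intro!: exI[of _ "0\<^sub>v (dim_col A)"])
qed (use assms in auto)

lemma vec_norm2_mult_le_spectral_norm: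
  assumes A: "A \<in> carrier_mat p q" and v: "v \<in> carrier_vec q"
  shows "vec_norm2 (A *\<^sub>v v) \<le> spectral_norm A * vec_norm2 v"
proof (cases "vec_norm2 v = 0")
  case True
  then have "v = 0\<^sub>v q" using vec_norm2_eq_0D[of v] v by simp
  then have "A *\<^sub>v v = 0\<^sub>v p" using A by auto
  then show ?thesis using True by simp
next
  case False
  define c where "c = vec_norm2 v"
  have c: "c > 0" using False unfolding c_def by (simp add: less_le)
  define w where "w = complex_of_real (1 / c) \<cdot>\<^sub>v v"
  have w: "w \<in> carrier_vec q" "vec_norm2 w \<le> 1"
    using v c unfolding w_def vec_norm2_smult by (auto simp: norm_divide simp flip: c_def)
  have "A *\<^sub>v v = complex_of_real c \<cdot>\<^sub>v (A *\<^sub>v w)"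
    using A v c unfolding w_def by (simp add: mult_mat_vec smult_smult_assoc)
  then have "vec_norm2 (A *\<^sub>v v) = c * vec_norm2 (A *\<^sub>v w)"
    using c by (simp add: vec_norm2_smult)
  also have "\<dots> \<le> c * spectral_norm A"
    using c w A by (intro mult_left_mono spectral_norm_upper) auto
  finally show ?thesis by (simp add: c_def mult.commute)
qed

lemma vec_norm2_col_le_spectral_norm:
  assumes "j < dim_col A"
  shows "vec_norm2 (col A j) \<le> spectral_norm A"
proof -
  have "A *\<^sub>v unit_vec (dim_col A) j = col A j"
    using assms by (intro mult_mat_unit_vec) auto
  then show ?thesis
    using assms spectral_norm_upper[of "unit_vec (dim_col A) j" A] by simp
qed

text \<open>Applying \<open>A\<close> to the conjugate of its \<open>i\<close>-th row produces the square of the norm of that row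
  as the \<open>i\<close>-th entry.\<close>

lemma vec_norm2_row_le_spectral_norm:
  assumes i: "i < dim_row A"
  shows "vec_norm2 (row A i) \<le> spectral_norm A"
proof -
  let ?v = "conjugate (row A i)"
  have v: "?v \<in> carrier_vec (dim_col A)" by (intro carrier_vecI) simp
  have n: "vec_norm2 ?v = vec_norm2 (row A i)"
    by (simp add: vec_norm2_def)
  have "(vec_norm2 (row A i))\<^sup>2 = cmod (row A i \<bullet>c row A i)"
    unfolding of_real_vec_norm2_sq[symmetric] norm_of_real by simp
  also have "\<dots> = cmod ((A *\<^sub>v ?v) $ i)" using i by simp
  also have "\<dots> \<le> vec_norm2 (A *\<^sub>v ?v)" using i by (intro cmod_index_le_vec_norm2) simp
  also have "\<dots> \<le> spectral_norm A * vec_norm2 (row A i)"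
    using vec_norm2_mult_le_spectral_norm[OF carrier_matI[OF refl refl] v] by (simp only: n)
  finally have "vec_norm2 (row A i) * vec_norm2 (row A i) \<le> spectral_norm A * vec_norm2 (row A i)"
    by (simp add: power2_eq_square)
  then show ?thesis
    using spectral_norm_nonneg[of A] vec_norm2_nonneg[of "row A i"]
    by (metis less_le mult_le_cancel_right_pos)
qed

section \<open>Block matrices, truncated singular value decompositions and tensors\<close>

lemma sum_div_mod:
  fixes g :: "nat \<Rightarrow> nat \<Rightarrow> 'a::comm_monoid_add"
  shows "(\<Sum>p<N * m. g (p div m) (p mod m)) = (\<Sum>i<N. \<Sum>j<m. g i j)"
proof -
  have "(\<Sum>p<N * m. g (p div m) (p mod m)) =
      (\<Sum>i<N. \<Sum>p\<in>{i * m..<i * m + m}. g (p div m) (p mod m))"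
    by (rule sum.nat_group[symmetric])
  also have "\<dots> = (\<Sum>i<N. \<Sum>j<m. g i j)"
  proof (rule sum.cong[OF refl])
    fix i
    have "(\<Sum>p\<in>{i * m..<i * m + m}. g (p div m) (p mod m)) =
        (\<Sum>j<m. g ((j + i * m) div m) ((j + i * m) mod m))"
      using sum.shift_bounds_nat_ivl[of "\<lambda>p. g (p div m) (p mod m)" 0 "i * m" m]
      by (simp add: add.commute atLeast0LessThan)
    also have "\<dots> = (\<Sum>j<m. g i j)"
      by (rule sum.cong) auto
    finally show "(\<Sum>p\<in>{i * m..<i * m + m}. g (p div m) (p mod m)) = (\<Sum>j<m. g i j)" .
  qed
  finally show ?thesis .
qed

lemma concat_equal_lengths:
  assumes "\<And>xs. xs \<in> set xss \<Longrightarrow> length xs = m"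
  shows "length (concat xss) = length xss * m"
    and "i < length xss \<Longrightarrow> j < m \<Longrightarrow> concat xss ! (i * m + j) = xss ! i ! j"
proof -
  show "length (concat xss) = length xss * m"
    using assms by (induction xss) auto
  show "concat xss ! (i * m + j) = xss ! i ! j" if "i < length xss" "j < m"
    using assms that
  proof (induction xss arbitrary: i)
    case (Cons xs xss)
    show ?case
      using Cons.IH[of "i - 1"] Cons.prems
      by (cases i) (auto simp: nth_append)
  qed simp
qed

lemma hblocks_equal_dims:
  assumes "\<And>B. B \<in> set As \<Longrightarrow> B \<in> carrier_mat p m"
  shows "hblocks p As \<in> carrier_mat p (length As * m)"
    and "i < length As \<Longrightarrow> j < m \<Longrightarrow> u < p \<Longrightarrow> hblocks p As $$ (u, i * m + j) = As ! i $$ (u, j)"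
proof -
  have l: "length xs = m" if "xs \<in> set (map cols As)" for xs using that assms by fastforce
  have len: "length (concat (map cols As)) = length As * m"
    using concat_equal_lengths(1)[of "map cols As", OF l] by (simp del: length_concat)
  show "hblocks p As \<in> carrier_mat p (length As * m)"
    unfolding hblocks_def len[symmetric] by (rule mat_of_cols_carrier(1))
  show "hblocks p As $$ (u, i * m + j) = As ! i $$ (u, j)" if ij: "i < length As" "j < m" "u < p"
  proof -
    have B: "As ! i \<in> carrier_mat p m" using assms ij by simp
    have "i * m + j < length As * m"
    proof -
      have "i * m + j < (i + 1) * m" using ij by simp
      also have "\<dots> \<le> length As * m" using ij by (intro mult_right_mono) auto
      finally show ?thesis .
    qed
    then have "hblocks p As $$ (u, i * m + j) = concat (map cols As) ! (i * m + j) $ u"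
      unfolding hblocks_def using ij len by (intro mat_of_cols_index) (simp_all del: length_concat)
    also have "concat (map cols As) ! (i * m + j) = col (As ! i) j"
      using concat_equal_lengths(2)[of "map cols As", OF l, of i j] ij B by simp
    finally show ?thesis using ij B by simp
  qed
qed

lemma hblocks_two:
  assumes U: "U1 \<in> carrier_mat p q1" "U2 \<in> carrier_mat p q2"
  shows "hblocks p [U1, U2] =
    mat p (q1 + q2) (\<lambda>(u, v). if v < q1 then U1 $$ (u, v) else U2 $$ (u, v - q1))"
  using assms by (intro eq_matI) (auto simp: hblocks_def mat_of_cols_index nth_append)

lemma diag_block_mat_two_diag:
  "diag_block_mat [mat_diag p f, mat_diag q (\<lambda>i. f (p + i))] = mat_diag (p + q) f"
  by (rule eq_matI) (auto simp: mat_diag_def Let_def)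

text \<open>Embedding \<open>v\<close> as one block of an otherwise zero vector shows that each block of a matrix
  is as contractive as the matrix.\<close>

lemma vec_norm2_hblocks_block_le:
  assumes Q: "\<And>B. B \<in> set As \<Longrightarrow> B \<in> carrier_mat p m" and o: "orthonormal_rows (hblocks p As)"
    and i: "i < length As" and v: "v \<in> carrier_vec m"
  shows "vec_norm2 (As ! i *\<^sub>v v) \<le> vec_norm2 v"
proof -
  let ?L = "length As" and ?Q = "hblocks p As"
  define x where "x = vec (?L * m) (\<lambda>q. if q div m = i then v $ (q mod m) else 0)"
  have Qc: "?Q \<in> carrier_mat p (?L * m)" by (rule hblocks_equal_dims(1)[OF Q])
  have Bc: "As ! i \<in> carrier_mat p m" using Q i by simp
  have x: "x \<in> carrier_vec (?L * m)" by (simp add: x_def)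
  have "?Q *\<^sub>v x = As ! i *\<^sub>v v"
  proof (rule eq_vecI)
    fix u assume "u < dim_vec (As ! i *\<^sub>v v)"
    then have u: "u < p" using Bc by simp
    have "(?Q *\<^sub>v x) $ u = (\<Sum>q<?L * m. ?Q $$ (u, q) * x $ q)"
      by (rule mult_mat_vec_index[OF Qc x u])
    also have "\<dots> = (\<Sum>q<?L * m. ?Q $$ (u, (q div m) * m + q mod m) *
        (if q div m = i then v $ (q mod m) else 0))"
      by (rule sum.cong) (auto simp: x_def)
    also have "\<dots> = (\<Sum>i'<?L. \<Sum>j<m. ?Q $$ (u, i' * m + j) * (if i' = i then v $ j else 0))"
      by (rule sum_div_mod)
    also have "\<dots> = (\<Sum>i'<?L. if i' = i then \<Sum>j<m. ?Q $$ (u, i * m + j) * v $ j else 0)"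
      by (rule sum.cong) auto
    also have "\<dots> = (\<Sum>j<m. ?Q $$ (u, i * m + j) * v $ j)"
      using i by simp
    also have "\<dots> = (\<Sum>j<m. As ! i $$ (u, j) * v $ j)"
      using hblocks_equal_dims(2)[OF Q i _ u] by (intro sum.cong) auto
    also have "\<dots> = (As ! i *\<^sub>v v) $ u"
      by (rule mult_mat_vec_index[OF Bc v u, symmetric])
    finally show "(?Q *\<^sub>v x) $ u = (As ! i *\<^sub>v v) $ u" .
  qed (use Qc Bc in simp)
  moreover have "(vec_norm2 x)\<^sup>2 = (vec_norm2 v)\<^sup>2"
  proof -
    have "(vec_norm2 x)\<^sup>2 = (\<Sum>q<?L * m. if q div m = i then (cmod (v $ (q mod m)))\<^sup>2 else 0)"
      unfolding vec_norm2_sq by (rule sum.cong) (auto simp: x_def)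
    also have "\<dots> = (\<Sum>i'<?L. \<Sum>j<m. if i' = i then (cmod (v $ j))\<^sup>2 else 0)"
      by (rule sum_div_mod)
    also have "\<dots> = (\<Sum>i'<?L. if i' = i then \<Sum>j<m. (cmod (v $ j))\<^sup>2 else 0)"
      by (rule sum.cong) auto
    also have "\<dots> = (vec_norm2 v)\<^sup>2"
      using i v by (simp add: vec_norm2_sq)
    finally show ?thesis .
  qed
  then have "vec_norm2 x = vec_norm2 v" by simp
  ultimately show ?thesis
    using vec_norm2_orthonormal_rows_le[OF Qc o x] by simp
qed

lemma mat_diag_mult_vec_index:
  fixes w :: "complex vec"
  assumes "w \<in> carrier_vec r" "l < r"
  shows "(mat_diag r f *\<^sub>v w) $ l = f l * w $ l"
proof -
  have "(mat_diag r f *\<^sub>v w) $ l = (\<Sum>j<r. mat_diag r f $$ (l, j) * w $ j)"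
    by (rule mult_mat_vec_index[OF mat_diag_dim assms])
  also have "\<dots> = (\<Sum>j<r. if l = j then f l * w $ l else 0)"
    using assms by (intro sum.cong) (auto simp: mat_diag_def)
  finally show ?thesis using assms by simp
qed

lemma mat_diag_const_mult_vec:
  fixes w :: "complex vec"
  assumes w: "w \<in> carrier_vec r"
  shows "mat_diag r (\<lambda>_. c) *\<^sub>v w = c \<cdot>\<^sub>v w"
proof (rule eq_vecI)
  fix l assume "l < dim_vec (c \<cdot>\<^sub>v w)"
  then have l: "l < r" using w by simp
  then show "(mat_diag r (\<lambda>_. c) *\<^sub>v w) $ l = (c \<cdot>\<^sub>v w) $ l"
    using w mat_diag_mult_vec_index[OF w l, of "\<lambda>_. c"] by (simp del: index_mult_mat_vec)
qed (use w in \<open>simp add: mat_diag_def\<close>)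

lemma vec_norm2_mat_diag_mono:
  assumes w: "w \<in> carrier_vec r" and "\<And>l. l < r \<Longrightarrow> cmod (f l) \<le> cmod (g l)"
  shows "vec_norm2 (mat_diag r f *\<^sub>v w) \<le> vec_norm2 (mat_diag r g *\<^sub>v w)"
proof (rule vec_norm2_mono)
  show "dim_vec (mat_diag r f *\<^sub>v w) = dim_vec (mat_diag r g *\<^sub>v w)"
    by (simp add: mat_diag_def)
  fix l assume "l < dim_vec (mat_diag r g *\<^sub>v w)"
  then have l: "l < r" by (simp add: mat_diag_def)
  show "cmod ((mat_diag r f *\<^sub>v w) $ l) \<le> cmod ((mat_diag r g *\<^sub>v w) $ l)"
    using assms(2)[OF l]
    by (simp add: mat_diag_mult_vec_index[OF w l] norm_mult mult_right_mono del: index_mult_mat_vec)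
qed

text \<open>The part \<open>N\<^sub>i\<close> of the block \<open>A\<^sub>i\<close> that the truncation discards is obtained by replacing the
  leading singular values by \<open>0\<close>. Since \<open>[U\<^sub>1, U]\<close> is an isometry, its norm is governed by the
  diagonal factor. The remaining singular values are at most \<open>\<sigma> r1\<close>, and none exceeds the
  original one in the same place, so \<open>N\<^sub>i\<close> is dominated both by \<open>\<sigma> r1\<close> and by \<open>A\<^sub>i\<close> itself.\<close>

lemma truncated_svd_block:
  fixes \<sigma> :: "nat \<Rightarrow> real" and V A' Ai :: "nat \<Rightarrow> complex mat"
  assumes U_dim: "U1 \<in> carrier_mat r r1" "U \<in> carrier_mat r (r - r1)" and r1: "r1 < r"
    and U_unitary: "unitary_mat (hblocks r [U1, U])"
    and V_dim: "\<And>i. i \<le> d \<Longrightarrow> V i \<in> carrier_mat m r"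
    and V_orth: "orthonormal_rows (hblocks r (map (\<lambda>i. mat_adjoint (V i)) [0..<d + 1]))"
    and \<sigma>_decr: "\<And>i j. i \<le> j \<Longrightarrow> j < r \<Longrightarrow> \<sigma> j \<le> \<sigma> i"
    and \<sigma>_nonneg: "\<And>i. i < r \<Longrightarrow> 0 \<le> \<sigma> i"
    and Ai_dim: "\<And>i. i \<le> d \<Longrightarrow> Ai i \<in> carrier_mat r m"
    and svd: "hblocks r (map Ai [0..<d + 1]) = hblocks r [U1, U] *
        diag_block_mat [mat_diag r1 (\<lambda>i. complex_of_real (\<sigma> i)),
          mat_diag (r - r1) (\<lambda>i. complex_of_real (\<sigma> (r1 + i)))] *
        hblocks r (map (\<lambda>i. mat_adjoint (V i)) [0..<d + 1])"
    and A': "A' i = mat_diag r1 (\<lambda>i. complex_of_real (\<sigma> i)) * first_rows r1 (mat_adjoint (V i))"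
    and i: "i \<le> d"
  obtains N where "N \<in> carrier_mat r m" "Ai i = U1 * A' i + N"
    "\<And>v. v \<in> carrier_vec m \<Longrightarrow> vec_norm2 (N *\<^sub>v v) \<le> \<sigma> r1 * vec_norm2 v"
    "\<And>v. v \<in> carrier_vec m \<Longrightarrow> vec_norm2 (N *\<^sub>v v) \<le> vec_norm2 (Ai i *\<^sub>v v)"
proof -
  let ?G = "hblocks r [U1, U]"
  let ?S = "\<lambda>f. mat_diag r (\<lambda>l. complex_of_real (f l))"
  let ?VH = "mat_adjoint (V i)"
  \<comment> \<open>The diagonal left over once the leading \<open>r1\<close> singular values are split off.\<close>
  define \<tau> where "\<tau> l = (if l < r1 then 0 else \<sigma> l)" for l
  have r: "r1 + (r - r1) = r" using r1 by simp
  have G: "?G = mat r r (\<lambda>(u, v). if v < r1 then U1 $$ (u, v) else U $$ (u, v - r1))"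
    using hblocks_two[OF U_dim] r by simp
  then have Gc: "?G \<in> carrier_mat r r" by simp
  have Gi: "orthonormal_cols ?G" using U_unitary by (simp add: unitary_mat_def)
  have VH: "?VH \<in> carrier_mat r m" using V_dim[OF i] by auto
  have blocks_VH: "B \<in> carrier_mat r m" if "B \<in> set (map (\<lambda>i. mat_adjoint (V i)) [0..<d + 1])" for B
    using that V_dim by fastforce
  have blocks_A: "B \<in> carrier_mat r m" if "B \<in> set (map Ai [0..<d + 1])" for B
    using that Ai_dim by fastforce
  have SV: "?S f * ?VH \<in> carrier_mat r m" for f by (rule mult_carrier_mat[OF mat_diag_dim VH])
  have prod: "?G * (?S f * ?VH) \<in> carrier_mat r m" for f by (rule mult_carrier_mat[OF Gc SV])
  have norm_GS: "vec_norm2 ((?G * (?S f * ?VH)) *\<^sub>v v) = vec_norm2 (?S f *\<^sub>v (?VH *\<^sub>v v))"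
    if v: "v \<in> carrier_vec m" for f v
  proof -
    have "(?G * (?S f * ?VH)) *\<^sub>v v = ?G *\<^sub>v ((?S f * ?VH) *\<^sub>v v)"
      by (rule assoc_mult_mat_vec[OF Gc SV v])
    also have "(?S f * ?VH) *\<^sub>v v = ?S f *\<^sub>v (?VH *\<^sub>v v)"
      by (rule assoc_mult_mat_vec[OF mat_diag_dim VH v])
    finally show ?thesis
      using vec_norm2_isometry[OF Gc Gi]
        mult_mat_vec_carrier[OF mat_diag_dim mult_mat_vec_carrier[OF VH v]] by simp
  qed

  have Ai: "Ai i = ?G * (?S \<sigma> * ?VH)"
  proof (rule eq_matI)
    fix u j assume "u < dim_row (?G * (?S \<sigma> * ?VH))" "j < dim_col (?G * (?S \<sigma> * ?VH))"
    then have u: "u < r" and j: "j < m" using prod[of \<sigma>] by auto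
    let ?L = "[0..<d + 1]"
    have i': "i < length (map Ai ?L)" "i < length (map (\<lambda>i. mat_adjoint (V i)) ?L)"
      using i by simp_all
    have GS: "?G * ?S \<sigma> \<in> carrier_mat r r" by (rule mult_carrier_mat[OF Gc mat_diag_dim])
    have diag: "diag_block_mat [mat_diag r1 (\<lambda>i. complex_of_real (\<sigma> i)),
        mat_diag (r - r1) (\<lambda>i. complex_of_real (\<sigma> (r1 + i)))] = ?S \<sigma>"
      using diag_block_mat_two_diag[of r1 "\<lambda>i. complex_of_real (\<sigma> i)" "r - r1"] r by simp
    have ij: "i * m + j < (d + 1) * m"
    proof -
      have "i * m + j < (i + 1) * m" using j by simp
      also have "\<dots> \<le> (d + 1) * m" using i by (intro mult_right_mono) auto
      finally show ?thesis .
    qed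
    have Qc: "hblocks r (map (\<lambda>i. mat_adjoint (V i)) ?L) \<in> carrier_mat r ((d + 1) * m)"
      using hblocks_equal_dims(1)[of "map (\<lambda>i. mat_adjoint (V i)) ?L", OF blocks_VH]
      by (simp del: upt_Suc)
    have "Ai i $$ (u, j) = hblocks r (map Ai ?L) $$ (u, i * m + j)"
      using hblocks_equal_dims(2)[OF blocks_A i'(1) j u] i by (simp del: upt_Suc)
    also have "\<dots> = ((?G * ?S \<sigma>) * hblocks r (map (\<lambda>i. mat_adjoint (V i)) ?L)) $$ (u, i * m + j)"
      unfolding svd diag ..
    also have "\<dots> = (\<Sum>l<r. (?G * ?S \<sigma>) $$ (u, l) *
        hblocks r (map (\<lambda>i. mat_adjoint (V i)) ?L) $$ (l, i * m + j))"
      by (rule mult_mat_index[OF GS Qc u ij])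
    also have "\<dots> = (\<Sum>l<r. (?G * ?S \<sigma>) $$ (u, l) * ?VH $$ (l, j))"
      using hblocks_equal_dims(2)[OF blocks_VH i'(2) j] i
      by (intro sum.cong) (auto simp del: upt_Suc mat_adjoint_index)
    also have "\<dots> = ((?G * ?S \<sigma>) * ?VH) $$ (u, j)"
      by (rule mult_mat_index[OF GS VH u j, symmetric])
    also have "(?G * ?S \<sigma>) * ?VH = ?G * (?S \<sigma> * ?VH)"
      by (rule assoc_mult_mat[OF Gc mat_diag_dim VH])
    finally show "Ai i $$ (u, j) = (?G * (?S \<sigma> * ?VH)) $$ (u, j)" .
  qed (use Ai_dim[OF i] prod[of \<sigma>] in auto)

  have split: "Ai i = U1 * A' i + ?G * (?S \<tau> * ?VH)"
  proof (rule eq_matI)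
    fix u j assume "u < dim_row (U1 * A' i + ?G * (?S \<tau> * ?VH))"
      "j < dim_col (U1 * A' i + ?G * (?S \<tau> * ?VH))"
    then have u: "u < r" and j: "j < m" using prod[of \<tau>] by auto
    have fr: "first_rows r1 ?VH \<in> carrier_mat r1 m" using VH by (auto simp: first_rows_def)
    have A'c: "A' i \<in> carrier_mat r1 m" unfolding A' by (rule mult_carrier_mat[OF mat_diag_dim fr])
    have GS_index: "(?G * (?S f * ?VH)) $$ (u, j) = (\<Sum>l<r. ?G $$ (u, l) * (f l * ?VH $$ (l, j)))" for f
      using mult_mat_index[OF Gc SV u j, of f] j VH
      by (simp add: mat_diag_mult_left[OF VH])
    have "(U1 * A' i) $$ (u, j) = (\<Sum>l<r1. U1 $$ (u, l) * A' i $$ (l, j))"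
      by (rule mult_mat_index[OF U_dim(1) A'c u j])
    also have "\<dots> = (\<Sum>l<r1. ?G $$ (u, l) * (\<sigma> l * ?VH $$ (l, j)))"
      using u j r1 VH unfolding A' mat_diag_mult_left[OF fr]
      by (intro sum.cong) (auto simp: G first_rows_def)
    also have "\<dots> = (\<Sum>l<r. if l < r1 then ?G $$ (u, l) * (\<sigma> l * ?VH $$ (l, j)) else 0)"
      using r1 by (intro sum.mono_neutral_cong_left) auto
    finally have "(U1 * A' i + ?G * (?S \<tau> * ?VH)) $$ (u, j) =
        (\<Sum>l<r. (if l < r1 then ?G $$ (u, l) * (\<sigma> l * ?VH $$ (l, j)) else 0) +
          ?G $$ (u, l) * (\<tau> l * ?VH $$ (l, j)))"
      using carrier_matD[OF Gc] carrier_matD[OF VH] u j GS_index[of \<tau>]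
      by (simp add: sum.distrib del: index_mult_mat(1))
    also have "\<dots> = (\<Sum>l<r. ?G $$ (u, l) * (\<sigma> l * ?VH $$ (l, j)))"
      by (rule sum.cong) (auto simp: \<tau>_def)
    finally show "Ai i $$ (u, j) = (U1 * A' i + ?G * (?S \<tau> * ?VH)) $$ (u, j)"
      unfolding Ai GS_index ..
  qed (use Ai_dim[OF i] prod[of \<tau>] in auto)

  show ?thesis
  proof (rule that[OF prod split])
    fix v :: "complex vec" assume v: "v \<in> carrier_vec m"
    have w: "?VH *\<^sub>v v \<in> carrier_vec r" by (rule mult_mat_vec_carrier[OF VH v])
    have \<tau>_le: "cmod (complex_of_real (\<tau> l)) \<le> cmod (complex_of_real (\<sigma> l))"
      "cmod (complex_of_real (\<tau> l)) \<le> cmod (complex_of_real (\<sigma> r1))" if "l < r" for l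
      using that \<sigma>_nonneg[of l] \<sigma>_nonneg[of r1] \<sigma>_decr[of r1 l] r1 by (auto simp: \<tau>_def)
    show "vec_norm2 ((?G * (?S \<tau> * ?VH)) *\<^sub>v v) \<le> vec_norm2 (Ai i *\<^sub>v v)"
      unfolding Ai norm_GS[OF v] using \<tau>_le by (intro vec_norm2_mat_diag_mono[OF w]) auto
    have "?VH = map (\<lambda>i. mat_adjoint (V i)) [0..<d + 1] ! i"
      using i by (simp del: upt_Suc)
    then have VH_le: "vec_norm2 (?VH *\<^sub>v v) \<le> vec_norm2 v"
      using vec_norm2_hblocks_block_le[OF blocks_VH V_orth _ v, of i] i by (simp del: upt_Suc)
    have "vec_norm2 ((?G * (?S \<tau> * ?VH)) *\<^sub>v v) \<le> vec_norm2 (?S (\<lambda>_. \<sigma> r1) *\<^sub>v (?VH *\<^sub>v v))"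
      unfolding norm_GS[OF v] using \<tau>_le by (intro vec_norm2_mat_diag_mono[OF w]) auto
    also have "?S (\<lambda>_. \<sigma> r1) *\<^sub>v (?VH *\<^sub>v v) = complex_of_real (\<sigma> r1) \<cdot>\<^sub>v (?VH *\<^sub>v v)"
      by (rule mat_diag_const_mult_vec[OF w])
    also have "vec_norm2 \<dots> \<le> \<sigma> r1 * vec_norm2 v"
      using VH_le \<sigma>_nonneg[OF r1] by (simp add: vec_norm2_smult mult_left_mono)
    finally show "vec_norm2 ((?G * (?S \<tau> * ?VH)) *\<^sub>v v) \<le> \<sigma> r1 * vec_norm2 v" .
  qed
qed

definition mat_poly ::
    "nat \<Rightarrow> nat \<Rightarrow> nat \<Rightarrow> (nat \<Rightarrow> complex mat) \<Rightarrow> complex \<Rightarrow> complex mat" where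
  "mat_poly n m N X \<theta> = mat n m (\<lambda>(u, v). \<Sum>i\<le>N. \<theta> ^ i * X i $$ (u, v))"

lemma tensor_fun_eq_mat_poly:
  assumes Z: "Z \<in> carrier_mat n r" and B: "\<And>i. i \<le> d \<Longrightarrow> B i \<in> carrier_mat r m"
    and a: "\<And>i j l. i \<le> d \<Longrightarrow> j < m \<Longrightarrow> l < r \<Longrightarrow> a i j l = B i $$ (l, j)"
  shows "tensor_fun d m a Z = mat_poly n m d (\<lambda>i. Z * B i)"
proof
  fix \<theta>
  let ?K = "mat ((d + 1) * dim_row Z) m (\<lambda>(p, q). \<Sum>l<dim_col Z.
       kron (slice3 (d + 1) m a l) (mat_of_cols (dim_row Z) [col Z l]) $$ (p, q))"
  have n: "dim_row Z = n" "dim_col Z = r" using Z by auto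
  have P: "P_mat n d \<theta> \<in> carrier_mat n ((d + 1) * n)" by (simp add: P_mat_def kron_def)
  have K: "?K \<in> carrier_mat ((d + 1) * n) m" by (simp add: n)
  show "tensor_fun d m a Z \<theta> = mat_poly n m d (\<lambda>i. Z * B i) \<theta>"
  proof (rule eq_matI)
    fix u v assume "u < dim_row (mat_poly n m d (\<lambda>i. Z * B i) \<theta>)"
      "v < dim_col (mat_poly n m d (\<lambda>i. Z * B i) \<theta>)"
    then have u: "u < n" and v: "v < m" by (simp_all add: mat_poly_def)
    define g where "g i q = (if u = q then \<theta> ^ i * (Z * B i) $$ (u, v) else 0)" for i q
    have entry: "P_mat n d \<theta> $$ (u, p) * ?K $$ (p, v) = g (p div n) (p mod n)"
      if p: "p < (d + 1) * n" for p
    proof -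
      have pd: "p div n < d + 1" using p by (simp add: less_mult_imp_div_less)
      have pm: "p mod n < n" using u by simp
      have "P_mat n d \<theta> $$ (u, p) = (if u = p mod n then \<theta> ^ (p div n) else 0)"
        using u pd pm p by (simp add: P_mat_def kron_def)
      moreover have "?K $$ (p, v) = (\<Sum>l<r. Z $$ (p mod n, l) * B (p div n) $$ (l, v))"
        using p v pd pm n
        by (auto simp: kron_def slice3_def mat_of_cols_index a mult.commute intro!: sum.cong)
      moreover have "\<dots> = (Z * B (p div n)) $$ (p mod n, v)"
        using pd by (intro mult_mat_index[OF Z B pm v, symmetric]) simp
      ultimately show ?thesis by (simp add: g_def)
    qed
    have "tensor_fun d m a Z \<theta> $$ (u, v) = (\<Sum>p<(d + 1) * n. P_mat n d \<theta> $$ (u, p) * ?K $$ (p, v))"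
      unfolding tensor_fun_def n(1) using mult_mat_index[OF P K u v] unfolding n .
    also have "\<dots> = (\<Sum>p<(d + 1) * n. g (p div n) (p mod n))"
      by (rule sum.cong[OF refl]) (rule entry, simp)
    also have "\<dots> = (\<Sum>i<d + 1. \<Sum>q<n. g i q)"
      by (rule sum_div_mod)
    also have "\<dots> = (\<Sum>i\<le>d. \<theta> ^ i * (Z * B i) $$ (u, v))"
      using u by (intro sum.cong) (auto simp: g_def)
    finally show "tensor_fun d m a Z \<theta> $$ (u, v) = mat_poly n m d (\<lambda>i. Z * B i) \<theta> $$ (u, v)"
      using u v by (simp add: mat_poly_def)
  qed (use P K in \<open>auto simp: tensor_fun_def mat_poly_def n\<close>)
qed

section \<open>Derivatives of analytic matrix functions\<close>

lemma higher_deriv_sum_cmult: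
  fixes f :: "'i \<Rightarrow> complex \<Rightarrow> complex"
  assumes "finite I" and S: "open S" "z \<in> S" and f: "\<And>i. i \<in> I \<Longrightarrow> f i holomorphic_on S"
  shows "(deriv ^^ j) (\<lambda>w. \<Sum>i\<in>I. c i * f i w) z = (\<Sum>i\<in>I. c i * (deriv ^^ j) (f i) z)"
  using assms(1) f
proof induction
  case (insert x I)
  have "(deriv ^^ j) (\<lambda>w. c x * f x w + (\<Sum>i\<in>I. c i * f i w)) z =
      (deriv ^^ j) (\<lambda>w. c x * f x w) z + (deriv ^^ j) (\<lambda>w. \<Sum>i\<in>I. c i * f i w) z"
    using insert.prems S by (intro higher_deriv_add[of _ S]) (auto intro!: holomorphic_intros)
  also have "(deriv ^^ j) (\<lambda>w. c x * f x w) z = c x * (deriv ^^ j) (f x) z"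
    using insert.prems S by (intro higher_deriv_cmult[of _ S]) auto
  finally show ?case using insert by simp
qed simp

lemma higher_deriv_ident_mult_at_0:
  assumes g: "g holomorphic_on S" and S: "open S" "0 \<in> S"
  shows "(deriv ^^ Suc i) (\<lambda>w. w * g w) 0 = of_nat (Suc i) * (deriv ^^ i) g 0"
proof -
  have "(deriv ^^ Suc i) (\<lambda>w. w * g w) 0 = (\<Sum>l = 0..Suc i.
      of_nat (Suc i choose l) * (deriv ^^ l) (\<lambda>w. w) 0 * (deriv ^^ (Suc i - l)) g 0)"
    by (rule higher_deriv_mult[OF _ g S]) simp
  also have "\<dots> = (\<Sum>l = 0..Suc i. if l = 1 then of_nat (Suc i) * (deriv ^^ i) g 0 else 0)"
    by (rule sum.cong[OF refl]) (simp only: higher_deriv_ident, auto)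
  also have "\<dots> = of_nat (Suc i) * (deriv ^^ i) g 0"
    by (subst sum.delta) auto
  finally show ?thesis .
qed

text \<open>With \<open>h \<lambda> = M(0)\<^sup>-\<^sup>1 (M(0) - M(\<lambda>))\<close> the definition of \<open>B\<close> reads \<open>\<lambda> B(\<lambda>) = h \<lambda>\<close>, and
  differentiating this product \<open>i + 1\<close> times at \<open>0\<close> gives \<open>(i + 1) B\<^sup>(\<^sup>i\<^sup>)(0) = h\<^sup>(\<^sup>i\<^sup>+\<^sup>1\<^sup>)(0)\<close>.\<close>

lemma mat_deriv_B_fun:
  assumes \<rho>: "0 < \<rho>" and M_dim: "\<And>\<mu>. \<mu> \<in> ball 0 \<rho> \<Longrightarrow> M \<mu> \<in> carrier_mat n n"
    and hol: "\<And>p q. p < n \<Longrightarrow> q < n \<Longrightarrow> (\<lambda>\<mu>. M \<mu> $$ (p, q)) holomorphic_on ball 0 \<rho>"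
    and W: "mat_inv (M 0) \<in> carrier_mat n n"
  shows "mat_deriv i (B_fun M) 0 =
    (- 1 / of_nat (Suc i)) \<cdot>\<^sub>m (mat_inv (M 0) * mat_deriv (Suc i) M 0)"
proof (rule eq_matI)
  let ?W = "mat_inv (M 0)" and ?D = "mat_deriv (Suc i) M 0"
  have M0: "M 0 \<in> carrier_mat n n" using M_dim \<rho> by simp
  have D: "?D \<in> carrier_mat n n" using M0 by (auto simp: mat_deriv_def)
  have Bd: "dim_row (B_fun M 0) = n" "dim_col (B_fun M 0) = n" using M0 by (auto simp: B_fun_def)
  show "dim_row (mat_deriv i (B_fun M) 0) = dim_row ((- 1 / of_nat (Suc i)) \<cdot>\<^sub>m (?W * ?D))"
    "dim_col (mat_deriv i (B_fun M) 0) = dim_col ((- 1 / of_nat (Suc i)) \<cdot>\<^sub>m (?W * ?D))"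
    using W D Bd by (auto simp: mat_deriv_def)
  fix p q assume "p < dim_row ((- 1 / of_nat (Suc i)) \<cdot>\<^sub>m (?W * ?D))"
    "q < dim_col ((- 1 / of_nat (Suc i)) \<cdot>\<^sub>m (?W * ?D))"
  then have p: "p < n" and q: "q < n" using W D by auto
  define f where "f l \<mu> = M 0 $$ (l, q) - M \<mu> $$ (l, q)" for l \<mu>
  define h where "h \<mu> = (\<Sum>l<n. ?W $$ (p, l) * f l \<mu>)" for \<mu>
  define g where "g \<mu> = (if \<mu> = 0 then deriv h 0 else (h \<mu> - h 0) / (\<mu> - 0))" for \<mu>
  have f_hol: "f l holomorphic_on ball 0 \<rho>" if "l < n" for l
    unfolding f_def by (intro holomorphic_intros hol that q)
  have h_hol: "h holomorphic_on ball 0 \<rho>"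
    unfolding h_def by (intro holomorphic_intros f_hol) auto
  have g_hol: "g holomorphic_on ball 0 \<rho>"
    unfolding g_def by (rule pole_lemma_open[OF h_hol open_ball])
  have h0: "h 0 = 0" by (simp add: h_def f_def)
  have quot: "B_quot M \<mu> $$ (p, q) = g \<mu>" if \<mu>: "\<mu> \<in> ball 0 \<rho>" "\<mu> \<noteq> 0" for \<mu>
  proof -
    have d: "M 0 - M \<mu> \<in> carrier_mat n n" by (rule minus_carrier_mat[OF M_dim[OF \<mu>(1)]])
    have "(?W * (M 0 - M \<mu>)) $$ (p, q) = (\<Sum>l<n. ?W $$ (p, l) * (M 0 - M \<mu>) $$ (l, q))"
      by (rule mult_mat_index[OF W d p q])
    also have "\<dots> = h \<mu>"
      unfolding h_def f_def using M0 M_dim[OF \<mu>(1)] q by (intro sum.cong) auto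
    finally have "(?W * (M 0 - M \<mu>)) $$ (p, q) = h \<mu>" .
    then show ?thesis
      using W M_dim[OF \<mu>(1)] p q \<mu> h0
      by (simp add: B_quot_def g_def del: index_mult_mat(1) index_minus_mat(1))
  qed
  have ev: "\<forall>\<^sub>F \<mu> in at 0. g \<mu> = B_quot M \<mu> $$ (p, q)"
    using quot \<rho> by (auto simp: eventually_at dist_norm intro!: exI[of _ \<rho>])
  have "isCont g 0"
    using holomorphic_on_imp_continuous_on[OF g_hol] \<rho>
    by (simp add: continuous_on_eq_continuous_at)
  then have "((\<lambda>\<mu>. B_quot M \<mu> $$ (p, q)) \<longlongrightarrow> g 0) (at 0)"
    using Lim_transform_eventually[OF _ ev] by (simp add: isCont_def)
  then have "B_fun M 0 $$ (p, q) = g 0"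
    using M0 p q by (simp add: B_fun_def tendsto_Lim)
  then have B: "B_fun M \<mu> $$ (p, q) = g \<mu>" if "\<mu> \<in> ball 0 \<rho>" for \<mu>
    using quot[OF that] by (cases "\<mu> = 0") (auto simp: B_fun_def)
  have "(deriv ^^ Suc i) h 0 = (\<Sum>l<n. ?W $$ (p, l) * (deriv ^^ Suc i) (f l) 0)"
    unfolding h_def by (rule higher_deriv_sum_cmult[of _ "ball 0 \<rho>"]) (use f_hol \<rho> in auto)
  also have "\<dots> = (\<Sum>l<n. ?W $$ (p, l) * - (?D $$ (l, q)))"
  proof (rule sum.cong[OF refl])
    fix l assume l: "l \<in> {..<n}"
    have "(deriv ^^ Suc i) (f l) 0 =
        (deriv ^^ Suc i) (\<lambda>_. M 0 $$ (l, q)) 0 - (deriv ^^ Suc i) (\<lambda>\<mu>. M \<mu> $$ (l, q)) 0"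
      unfolding f_def using l hol q \<rho> by (intro higher_deriv_diff[of _ "ball 0 \<rho>"]) auto
    also have "\<dots> = - (?D $$ (l, q))"
      using M0 l q by (simp only: higher_deriv_const) (simp add: mat_deriv_def)
    finally show "?W $$ (p, l) * (deriv ^^ Suc i) (f l) 0 = ?W $$ (p, l) * - (?D $$ (l, q))"
      by simp
  qed
  also have "\<dots> = - ((?W * ?D) $$ (p, q))"
    unfolding mult_mat_index[OF W D p q] by (simp add: sum_negf)
  finally have hD: "(deriv ^^ Suc i) h 0 = - ((?W * ?D) $$ (p, q))" .
  have "h = (\<lambda>\<mu>. \<mu> * g \<mu>)"
    using h0 by (auto simp: g_def)
  then have "(deriv ^^ Suc i) h 0 = of_nat (Suc i) * (deriv ^^ i) g 0"
    using higher_deriv_ident_mult_at_0[OF g_hol, of i] \<rho> by simp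
  with hD have gD: "(deriv ^^ i) g 0 = - 1 / of_nat (Suc i) * (?W * ?D) $$ (p, q)"
    by (simp add: field_simps del: of_nat_Suc index_mult_mat(1))
  have "mat_deriv i (B_fun M) 0 $$ (p, q) = (deriv ^^ i) (\<lambda>\<mu>. B_fun M \<mu> $$ (p, q)) 0"
    using Bd p q by (simp add: mat_deriv_def)
  also have "\<dots> = (deriv ^^ i) g 0"
  proof (rule higher_deriv_cong_ev[OF _ refl])
    show "\<forall>\<^sub>F \<mu> in nhds 0. B_fun M \<mu> $$ (p, q) = g \<mu>"
      using eventually_nhds_in_open[of "ball 0 \<rho>" "0::complex"] \<rho> B
      by (auto elim: eventually_mono)
  qed
  finally show "mat_deriv i (B_fun M) 0 $$ (p, q) =
      ((- 1 / of_nat (Suc i)) \<cdot>\<^sub>m (?W * ?D)) $$ (p, q)"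
    using gD W D p q by (simp del: of_nat_Suc index_mult_mat(1))
qed

text \<open>The scalar Cauchy inequality applies to \<open>\<lambda>\<mu>. \<langle>M(\<mu>) v, w\<rangle>\<close>, whose \<open>j\<close>-th derivative at \<open>0\<close> is
  \<open>\<langle>M\<^sub>j v, w\<rangle>\<close>. The choice \<open>w = M\<^sub>j v\<close> recovers the norm of \<open>M\<^sub>j v\<close>.\<close>

lemma spectral_norm_mat_deriv_le:
  assumes R: "0 < R" "cball 0 R \<subseteq> ball (0::complex) \<rho>"
    and M_dim: "\<And>\<mu>. \<mu> \<in> ball 0 \<rho> \<Longrightarrow> M \<mu> \<in> carrier_mat n n"
    and hol: "\<And>p q. p < n \<Longrightarrow> q < n \<Longrightarrow> (\<lambda>\<mu>. M \<mu> $$ (p, q)) holomorphic_on ball 0 \<rho>"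
    and bound: "\<And>\<mu>. \<mu> \<in> sphere 0 R \<Longrightarrow> spectral_norm (M \<mu>) \<le> c"
  shows "spectral_norm (mat_deriv j M 0) \<le> fact j * c / R ^ j"
proof (rule spectral_norm_le)
  let ?D = "mat_deriv j M 0"
  have sub: "0 \<in> ball (0::complex) \<rho>"
    using R(1) by (intro subsetD[OF R(2)]) simp
  have M0: "M 0 \<in> carrier_mat n n" by (rule M_dim[OF sub])
  have D: "?D \<in> carrier_mat n n" using M0 by (auto simp: mat_deriv_def)
  fix v assume "v \<in> carrier_vec (dim_col ?D)" and v1: "vec_norm2 v \<le> 1"
  then have v: "v \<in> carrier_vec n" using D by simp
  define w where "w = ?D *\<^sub>v v"
  have w: "w \<in> carrier_vec n" unfolding w_def by (rule mult_mat_vec_carrier[OF D v])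
  define b where "b x = v $ snd x * cnj (w $ fst x)" for x :: "nat \<times> nat"
  have form: "(L *\<^sub>v v) \<bullet>c w = (\<Sum>x\<in>{..<n} \<times> {..<n}. b x * L $$ x)"
    if L: "L \<in> carrier_mat n n" for L
  proof -
    have "(L *\<^sub>v v) \<bullet>c w = (\<Sum>p<n. (\<Sum>q<n. L $$ (p, q) * v $ q) * cnj (w $ p))"
      unfolding scalar_prod_def using L v w
      by (auto simp: atLeast0LessThan mult_mat_vec_index[OF L v] simp del: index_mult_mat_vec)
    also have "\<dots> = (\<Sum>x\<in>{..<n} \<times> {..<n}. b x * L $$ x)"
      unfolding sum.cartesian_product' b_def
      by (simp add: sum_distrib_left sum_distrib_right mult_ac)
    finally show ?thesis .
  qed
  define F where "F \<mu> = (\<Sum>x\<in>{..<n} \<times> {..<n}. b x * M \<mu> $$ x)" for \<mu>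
  have M_hol: "(\<lambda>\<mu>. M \<mu> $$ x) holomorphic_on ball 0 \<rho>" if "x \<in> {..<n} \<times> {..<n}" for x
    using that hol by auto
  have F_hol: "F holomorphic_on ball 0 \<rho>"
    unfolding F_def by (intro holomorphic_intros M_hol)
  have "cmod ((deriv ^^ j) F 0) \<le> fact j * (c * vec_norm2 w) / R ^ j"
  proof (rule Cauchy_inequality)
    show "F holomorphic_on ball 0 R"
      using R by (intro holomorphic_on_subset[OF F_hol]) auto
    show "continuous_on (cball 0 R) F"
      using R by (intro holomorphic_on_imp_continuous_on holomorphic_on_subset[OF F_hol]) auto
    fix \<mu> assume "cmod (0 - \<mu>) = R"
    then have \<mu>: "\<mu> \<in> sphere 0 R" by simp
    then have M\<mu>: "M \<mu> \<in> carrier_mat n n" using R by (intro M_dim) auto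
    have "cmod (F \<mu>) = cmod ((M \<mu> *\<^sub>v v) \<bullet>c w)"
      by (simp only: F_def form[OF M\<mu>])
    also have "\<dots> \<le> vec_norm2 (M \<mu> *\<^sub>v v) * vec_norm2 w"
      by (rule cmod_scalar_prod_le[OF mult_mat_vec_carrier[OF M\<mu> v] w])
    also have "\<dots> \<le> c * vec_norm2 w"
      using spectral_norm_upper[of v "M \<mu>"] bound[OF \<mu>] v v1 M\<mu> by (intro mult_right_mono) auto
    finally show "cmod (F \<mu>) \<le> c * vec_norm2 w" .
  qed (rule R)
  also have "(deriv ^^ j) F 0 = (\<Sum>x\<in>{..<n} \<times> {..<n}. b x * (deriv ^^ j) (\<lambda>\<mu>. M \<mu> $$ x) 0)"
    unfolding F_def by (rule higher_deriv_sum_cmult[OF _ open_ball sub M_hol]) auto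
  also have "\<dots> = (\<Sum>x\<in>{..<n} \<times> {..<n}. b x * ?D $$ x)"
    using M0 by (intro sum.cong) (auto simp: mat_deriv_def)
  also have "\<dots> = w \<bullet>c w"
    unfolding form[OF D, symmetric] w_def ..
  also have "cmod (w \<bullet>c w) = vec_norm2 w * vec_norm2 w"
    unfolding of_real_vec_norm2_sq[symmetric] norm_of_real by (simp add: power2_eq_square)
  finally have le: "vec_norm2 w * vec_norm2 w \<le> (fact j * c / R ^ j) * vec_norm2 w"
    by (simp add: mult_ac)
  have "complex_of_real R \<in> sphere 0 R" using R by simp
  then have "0 \<le> c" using bound spectral_norm_nonneg order_trans by blast
  then have "0 \<le> fact j * c / R ^ j" using R by simp
  with le show "vec_norm2 (?D *\<^sub>v v) \<le> fact j * c / R ^ j"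
    unfolding w_def[symmetric] using vec_norm2_nonneg[of w]
    by (metis less_le mult_le_cancel_right_pos)
qed

lemma bdd_above_spectral_norm_image:
  assumes S: "compact S" and M_dim: "\<And>\<mu>. \<mu> \<in> S \<Longrightarrow> M \<mu> \<in> carrier_mat n n"
    and cont: "\<And>p q. p < n \<Longrightarrow> q < n \<Longrightarrow> continuous_on S (\<lambda>\<mu>. M \<mu> $$ (p, q))"
  shows "bdd_above ((\<lambda>\<mu>. spectral_norm (M \<mu>)) ` S)"
proof -
  let ?f = "\<lambda>\<mu>. \<Sum>q<n. sqrt (\<Sum>p<n. (cmod (M \<mu> $$ (p, q)))\<^sup>2)"
  have "continuous_on S ?f"
    by (intro continuous_intros cont) auto
  then have "bdd_above (?f ` S)"
    by (intro bounded_imp_bdd_above compact_imp_bounded compact_continuous_image S)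
  moreover have "spectral_norm (M \<mu>) \<le> ?f \<mu>" if \<mu>: "\<mu> \<in> S" for \<mu>
  proof (rule spectral_norm_le)
    fix v assume v: "v \<in> carrier_vec (dim_col (M \<mu>))" "vec_norm2 v \<le> 1"
    have f: "?f \<mu> = (\<Sum>q<n. vec_norm2 (col (M \<mu>) q))"
      using M_dim[OF \<mu>] by (intro sum.cong) (auto simp: vec_norm2_def)
    have "vec_norm2 (M \<mu> *\<^sub>v v) \<le> ?f \<mu> * vec_norm2 v"
      unfolding f using v M_dim[OF \<mu>] by (intro vec_norm2_mult_le_sum_cols) auto
    also have "\<dots> \<le> ?f \<mu> * 1"
      using v by (intro mult_left_mono sum_nonneg) (auto intro: sum_nonneg)
    finally show "vec_norm2 (M \<mu> *\<^sub>v v) \<le> ?f \<mu>" by simp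
  qed
  ultimately show ?thesis
    unfolding bdd_above_def by (auto intro: order_trans)
qed

section \<open>The operator and the residual for polynomials\<close>

lemma first_cols_mat_poly:
  assumes "\<And>i. i \<le> N \<Longrightarrow> X i \<in> carrier_mat n m" "k \<le> m"
  shows "first_cols k (mat_poly n m N X \<theta>) = mat_poly n k N (\<lambda>i. first_cols k (X i)) \<theta>"
proof (rule eq_matI)
  fix u v assume uv: "u < dim_row (mat_poly n k N (\<lambda>i. first_cols k (X i)) \<theta>)"
    "v < dim_col (mat_poly n k N (\<lambda>i. first_cols k (X i)) \<theta>)"
  then have "X i $$ (u, v) = first_cols k (X i) $$ (u, v)" if "i \<le> N" for i
    using assms(1)[OF that] by (auto simp: mat_poly_def first_cols_def)
  then show "first_cols k (mat_poly n m N X \<theta>) $$ (u, v) =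
      mat_poly n k N (\<lambda>i. first_cols k (X i)) \<theta> $$ (u, v)"
    using assms(2) uv by (simp add: mat_poly_def first_cols_def)
qed (simp_all add: mat_poly_def first_cols_def)

lemma op_B_mat_poly:
  assumes M0: "M 0 \<in> carrier_mat n n" and X: "\<And>i. i \<le> N \<Longrightarrow> X i \<in> carrier_mat n m"
  shows "op_B M (mat_poly n m N X) \<theta> = mat n m (\<lambda>(u, v).
    (\<Sum>i\<le>N. \<theta> ^ Suc i / of_nat (Suc i) * X i $$ (u, v)) +
    (\<Sum>i\<le>N. (mat_deriv i (B_fun M) 0 * X i) $$ (u, v)))"
proof (rule eq_matI)
  let ?K = "\<lambda>i. mat_deriv i (B_fun M) 0"
  have K: "?K i \<in> carrier_mat n n" for i using M0 by (auto simp: mat_deriv_def B_fun_def)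
  have dims: "dim_row (M 0) = n" "dim_col (mat_poly n m N X 0) = m"
    using M0 by (auto simp: mat_poly_def)
  fix u v assume "u < dim_row (mat n m (\<lambda>(u, v).
      (\<Sum>i\<le>N. \<theta> ^ Suc i / of_nat (Suc i) * X i $$ (u, v)) + (\<Sum>i\<le>N. (?K i * X i) $$ (u, v))))"
    "v < dim_col (mat n m (\<lambda>(u, v).
      (\<Sum>i\<le>N. \<theta> ^ Suc i / of_nat (Suc i) * X i $$ (u, v)) + (\<Sum>i\<le>N. (?K i * X i) $$ (u, v))))"
  then have u: "u < n" and v: "v < m" by simp_all
  define \<psi> where "\<psi> t = col (mat_poly n m N X t) v" for t
  have \<psi>: "\<psi> t = vec n (\<lambda>p. \<Sum>i\<le>N. t ^ i * X i $$ (p, v))" for t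
    using v by (intro eq_vecI) (auto simp: \<psi>_def mat_poly_def)
  have int: "contour_integral (linepath 0 \<theta>) (\<lambda>t. \<psi> t $ u) =
      (\<Sum>i\<le>N. \<theta> ^ Suc i / of_nat (Suc i) * X i $$ (u, v))"
  proof -
    define F where "F t = (\<Sum>i\<le>N. t ^ Suc i / of_nat (Suc i) * X i $$ (u, v))" for t
    have "((\<lambda>t. t ^ Suc i / of_nat (Suc i) * x) has_field_derivative t ^ i * x) (at t)"
      for i and t x :: complex
      using DERIV_cmult_right[OF DERIV_cdivide[OF DERIV_power[OF DERIV_ident, where n = "Suc i"]],
          of "of_nat (Suc i)" x t UNIV]
      by (simp del: of_nat_Suc power_Suc)
    then have "(F has_field_derivative (\<psi> t $ u)) (at t within UNIV)" for t
      using u unfolding F_def by (auto simp: \<psi> intro!: DERIV_sum simp del: of_nat_Suc power_Suc)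
    then have "((\<lambda>t. \<psi> t $ u) has_contour_integral
        F (pathfinish (linepath 0 \<theta>)) - F (pathstart (linepath 0 \<theta>))) (linepath 0 \<theta>)"
      by (intro contour_integral_primitive[of UNIV] valid_path_linepath subset_UNIV)
    then have "contour_integral (linepath 0 \<theta>) (\<lambda>t. \<psi> t $ u) = F \<theta> - F 0"
      by (simp add: contour_integral_unique)
    then show ?thesis by (simp add: F_def)
  qed
  have coeff: "vec_deriv i \<psi> 0 = fact i \<cdot>\<^sub>v (if i \<le> N then col (X i) v else 0\<^sub>v n)" for i
  proof (rule eq_vecI)
    have "dim_vec (col (X i) v) = n" if "i \<le> N" using X[OF that] by simp
    then have d: "dim_vec (if i \<le> N then col (X i) v else 0\<^sub>v n) = n" by simp
    then show "dim_vec (vec_deriv i \<psi> 0) =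
        dim_vec (fact i \<cdot>\<^sub>v (if i \<le> N then col (X i) v else 0\<^sub>v n))"
      by (simp add: vec_deriv_def \<psi>)
    fix p assume "p < dim_vec (fact i \<cdot>\<^sub>v (if i \<le> N then col (X i) v else 0\<^sub>v n))"
    with d have p: "p < n" by simp
    have "1 / fact i * (deriv ^^ i) (\<lambda>w. \<psi> w $ p) 0 = (if i \<le> N then X i $$ (p, v) else 0)"
      by (rule taylor_coeff_poly) (use p in \<open>simp add: \<psi>\<close>)
    then have "(deriv ^^ i) (\<lambda>w. \<psi> w $ p) 0 = fact i * (if i \<le> N then X i $$ (p, v) else 0)"
      by (simp add: field_simps)
    then show "vec_deriv i \<psi> 0 $ p =
        (fact i \<cdot>\<^sub>v (if i \<le> N then col (X i) v else 0\<^sub>v n)) $ p"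
      using p X[of i] v by (auto simp: vec_deriv_def \<psi>)
  qed
  have entry: "(((1 / fact i) \<cdot>\<^sub>m ?K i) *\<^sub>v vec_deriv i \<psi> 0) $ u =
      (if i \<le> N then (?K i * X i) $$ (u, v) else 0)" for i
  proof -
    define x where "x = (if i \<le> N then col (X i) v else 0\<^sub>v n)"
    have x: "x \<in> carrier_vec n" using X[of i] v by (auto simp: x_def)
    have "((1 / fact i) \<cdot>\<^sub>m ?K i) *\<^sub>v (fact i \<cdot>\<^sub>v x) = ?K i *\<^sub>v x"
      using K[of i] x by (intro eq_vecI) auto
    then have "(((1 / fact i) \<cdot>\<^sub>m ?K i) *\<^sub>v vec_deriv i \<psi> 0) $ u = (?K i *\<^sub>v x) $ u"
      unfolding coeff x_def by simp
    also have "\<dots> = (if i \<le> N then (?K i * X i) $$ (u, v) else 0)"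
      using K[of i] X[of i] u v by (auto simp: x_def)
    finally show ?thesis .
  qed
  have "(\<Sum>i. (((1 / fact i) \<cdot>\<^sub>m ?K i) *\<^sub>v vec_deriv i \<psi> 0) $ u) =
      (\<Sum>i\<le>N. (((1 / fact i) \<cdot>\<^sub>m ?K i) *\<^sub>v vec_deriv i \<psi> 0) $ u)"
    by (rule suminf_finite) (simp_all only: entry, auto)
  also have "\<dots> = (\<Sum>i\<le>N. (?K i * X i) $$ (u, v))"
    by (rule sum.cong) (simp_all only: entry, auto)
  finally have ser: "(\<Sum>i. (((1 / fact i) \<cdot>\<^sub>m ?K i) *\<^sub>v vec_deriv i \<psi> 0) $ u) =
      (\<Sum>i\<le>N. (?K i * X i) $$ (u, v))" .
  have "op_B M (mat_poly n m N X) \<theta> $$ (u, v) = op_B_vec M \<psi> \<theta> $ u"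
    using u v by (simp add: op_B_def dims mat_of_cols_index \<psi>_def[abs_def])
  also have "\<dots> = (\<Sum>i\<le>N. \<theta> ^ Suc i / of_nat (Suc i) * X i $$ (u, v)) +
      (\<Sum>i\<le>N. (?K i * X i) $$ (u, v))"
    using u unfolding op_B_vec_def dims int[symmetric] ser[symmetric] by (simp add: \<psi>)
  finally show "op_B M (mat_poly n m N X) \<theta> $$ (u, v) = mat n m (\<lambda>(u, v).
      (\<Sum>i\<le>N. \<theta> ^ Suc i / of_nat (Suc i) * X i $$ (u, v)) +
      (\<Sum>i\<le>N. (?K i * X i) $$ (u, v))) $$ (u, v)"
    using u v by simp
qed (use M0 in \<open>auto simp: op_B_def mat_poly_def\<close>)

lemma op_B_first_cols_mat_poly:
  assumes M0: "M 0 \<in> carrier_mat n n" and X: "\<And>i. i \<le> N \<Longrightarrow> X i \<in> carrier_mat n m" and k: "k \<le> m"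
  shows "op_B M (\<lambda>t. first_cols k (mat_poly n m N X t)) \<theta> = mat n k (\<lambda>(u, v).
    (\<Sum>i\<le>N. \<theta> ^ Suc i / of_nat (Suc i) * X i $$ (u, v)) +
    (\<Sum>i\<le>N. (mat_deriv i (B_fun M) 0 * X i) $$ (u, v)))"
proof -
  let ?K = "\<lambda>i. mat_deriv i (B_fun M) 0"
  have K: "?K i \<in> carrier_mat n n" for i using M0 by (auto simp: mat_deriv_def B_fun_def)
  have fX: "first_cols k (X i) \<in> carrier_mat n k" if "i \<le> N" for i
    using X[OF that] by (auto simp: first_cols_def)
  have fX_index: "first_cols k (X i) $$ (u, v) = X i $$ (u, v)" if "i \<le> N" "u < n" "v < k" for i u v
    using X[OF that(1)] that by (auto simp: first_cols_def)
  have KX: "(?K i * first_cols k (X i)) $$ (u, v) = (?K i * X i) $$ (u, v)"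
    if "i \<le> N" "u < n" "v < k" for i u v
    using that k mult_mat_index[OF K fX, of i u v i] mult_mat_index[OF K X, of i u v i]
    by (simp add: fX_index del: index_mult_mat(1))
  have "(\<lambda>t. first_cols k (mat_poly n m N X t)) = mat_poly n k N (\<lambda>i. first_cols k (X i))"
    by (rule ext, rule first_cols_mat_poly[OF X k])
  then have "op_B M (\<lambda>t. first_cols k (mat_poly n m N X t)) \<theta> =
      op_B M (mat_poly n k N (\<lambda>i. first_cols k (X i))) \<theta>"
    by simp
  also have "\<dots> = mat n k (\<lambda>(u, v).
      (\<Sum>i\<le>N. \<theta> ^ Suc i / of_nat (Suc i) * first_cols k (X i) $$ (u, v)) +
      (\<Sum>i\<le>N. (?K i * first_cols k (X i)) $$ (u, v)))"
    by (rule op_B_mat_poly[of M, OF M0 fX])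
  finally show ?thesis
    by (auto simp: KX fX_index simp del: index_mult_mat(1) intro!: eq_matI)
qed

lemma mat_poly_mult:
  assumes X: "\<And>i. i \<le> N \<Longrightarrow> X i \<in> carrier_mat n m" and H: "H \<in> carrier_mat m k"
  shows "mat_poly n m N X \<theta> * H = mat_poly n k N (\<lambda>i. X i * H) \<theta>"
proof (rule eq_matI)
  have P: "mat_poly n m N X \<theta> \<in> carrier_mat n m" by (simp add: mat_poly_def)
  fix u v assume "u < dim_row (mat_poly n k N (\<lambda>i. X i * H) \<theta>)"
    "v < dim_col (mat_poly n k N (\<lambda>i. X i * H) \<theta>)"
  then have u: "u < n" and v: "v < k" by (simp_all add: mat_poly_def)
  have "(mat_poly n m N X \<theta> * H) $$ (u, v) =
      (\<Sum>l<m. (\<Sum>i\<le>N. \<theta> ^ i * X i $$ (u, l)) * H $$ (l, v))"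
    unfolding mult_mat_index[OF P H u v] using u by (intro sum.cong) (auto simp: mat_poly_def)
  also have "\<dots> = (\<Sum>i\<le>N. \<theta> ^ i * (\<Sum>l<m. X i $$ (u, l) * H $$ (l, v)))"
    by (simp add: sum_distrib_left sum_distrib_right mult.assoc) (rule sum.swap)
  also have "\<dots> = mat_poly n k N (\<lambda>i. X i * H) \<theta> $$ (u, v)"
    using u v by (simp add: mat_poly_def mult_mat_index[OF X H u v] del: index_mult_mat(1))
  finally show "(mat_poly n m N X \<theta> * H) $$ (u, v) = mat_poly n k N (\<lambda>i. X i * H) \<theta> $$ (u, v)" .
qed (use H in \<open>simp_all add: mat_poly_def\<close>)

text \<open>Integration would turn a term of degree \<open>d\<close> in \<open>\<Psi>\<^sub>k\<close> into one of degree \<open>d + 1\<close> in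
  \<open>B \<Psi>\<^sub>k = \<Psi> H\<close>, whose right-hand side has degree at most \<open>d\<close>.\<close>

lemma top_coeff_zero:
  assumes M0: "M 0 \<in> carrier_mat n n" and X: "\<And>i. i \<le> d \<Longrightarrow> X i \<in> carrier_mat n m" and k: "k \<le> m"
    and H: "H \<in> carrier_mat m k"
    and eq: "\<And>\<theta>. op_B M (\<lambda>t. first_cols k (mat_poly n m d X t)) \<theta> = mat_poly n m d X \<theta> * H"
    and u: "u < n" and v: "v < k"
  shows "X d $$ (u, v) = 0"
proof -
  \<comment> \<open>The coefficients of both sides at the entry \<open>(u, v)\<close>, as polynomials of degree \<open>d + 1\<close>.\<close>
  define c where "c i = (if i = 0 then \<Sum>i\<le>d. (mat_deriv i (B_fun M) 0 * X i) $$ (u, v)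
    else X (i - 1) $$ (u, v) / of_nat i)" for i
  define e where "e i = (if i \<le> d then (X i * H) $$ (u, v) else 0)" for i
  have "(\<Sum>i\<le>Suc d. c i * \<theta> ^ i) = (\<Sum>i\<le>Suc d. e i * \<theta> ^ i)" for \<theta>
  proof -
    have "op_B M (\<lambda>t. first_cols k (mat_poly n m d X t)) \<theta> $$ (u, v) =
        (\<Sum>i\<le>d. \<theta> ^ Suc i / of_nat (Suc i) * X i $$ (u, v)) + c 0"
      using u v by (subst op_B_first_cols_mat_poly[of M, OF M0 X k]) (simp_all add: c_def)
    also have "(\<Sum>i\<le>d. \<theta> ^ Suc i / of_nat (Suc i) * X i $$ (u, v)) = (\<Sum>i<Suc d. c (Suc i) * \<theta> ^ Suc i)"
      by (simp add: c_def lessThan_Suc_atMost mult.commute)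
    finally have l: "op_B M (\<lambda>t. first_cols k (mat_poly n m d X t)) \<theta> $$ (u, v) =
        (\<Sum>i\<le>Suc d. c i * \<theta> ^ i)"
      by (simp only: sum.atMost_shift) simp
    have "(mat_poly n m d X \<theta> * H) $$ (u, v) = (\<Sum>i\<le>Suc d. e i * \<theta> ^ i)"
      using u v by (subst mat_poly_mult[OF X H]) (simp_all add: mat_poly_def e_def mult.commute)
    then show ?thesis using l eq[of \<theta>] by simp
  qed
  then have "c (Suc d) = e (Suc d)"
    using polyfun_eq_coeffs[of c "Suc d" e] by simp
  then show ?thesis by (simp add: c_def e_def del: of_nat_Suc)
qed

text \<open>The coefficients of \<open>\<Delta> H - B \<Delta>\<^sub>k\<close> for \<open>\<Delta>(\<theta>) = \<Sum>\<^sub>i \<theta>\<^sup>i D\<^sub>i\<close>, where \<open>K i\<close> stands for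
  \<open>B\<^sup>(\<^sup>i\<^sup>)(0)\<close>.\<close>

definition residual_coeff ::
    "nat \<Rightarrow> nat \<Rightarrow> nat \<Rightarrow> (nat \<Rightarrow> complex mat) \<Rightarrow> complex mat \<Rightarrow> (nat \<Rightarrow> complex mat) \<Rightarrow> nat \<Rightarrow> complex mat" where
  "residual_coeff n k d K H D i = mat n k (\<lambda>(u, v). (D i * H) $$ (u, v) -
     (if i = 0 then \<Sum>j\<le>d. (K j * D j) $$ (u, v) else D (i - 1) $$ (u, v) / of_nat i))"

text \<open>The residual is linear in the function and vanishes for \<open>\<Psi>\<close>, so for \<open>\<Psi>' = \<Psi> - \<Delta>\<close> it depends
  on \<open>\<Delta>\<close> only.\<close>

lemma residual_eq_mat_poly:
  assumes M0: "M 0 \<in> carrier_mat n n" and k: "k \<le> m" and H: "H \<in> carrier_mat m k"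
    and X: "\<And>i. i \<le> d \<Longrightarrow> X i \<in> carrier_mat n m" and X': "\<And>i. i \<le> d \<Longrightarrow> X' i \<in> carrier_mat n m"
    and D: "\<And>i. i \<le> d \<Longrightarrow> D i \<in> carrier_mat n m" and split: "\<And>i. i \<le> d \<Longrightarrow> X i = X' i + D i"
    and top: "\<And>u v. u < n \<Longrightarrow> v < k \<Longrightarrow> D d $$ (u, v) = 0"
    and eq: "\<And>\<theta>. op_B M (\<lambda>t. first_cols k (mat_poly n m d X t)) \<theta> = mat_poly n m d X \<theta> * H"
  shows "op_B M (\<lambda>t. first_cols k (mat_poly n m d X' t)) \<theta> - mat_poly n m d X' \<theta> * H =
    mat_poly n k d (residual_coeff n k d (\<lambda>i. mat_deriv i (B_fun M) 0) H D) \<theta>"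
    (is "?res = mat_poly n k d ?Y \<theta>")
proof (rule eq_matI)
  let ?K = "\<lambda>i. mat_deriv i (B_fun M) 0"
  have K: "?K i \<in> carrier_mat n n" for i using M0 by (auto simp: mat_deriv_def B_fun_def)
  fix u v assume "u < dim_row (mat_poly n k d ?Y \<theta>)" "v < dim_col (mat_poly n k d ?Y \<theta>)"
  then have u: "u < n" and v: "v < k" by (simp_all add: mat_poly_def)
  define I where "I X = (\<Sum>i\<le>d. \<theta> ^ Suc i / of_nat (Suc i) * X i $$ (u, v))" for X :: "nat \<Rightarrow> complex mat"
  define L where "L X = (\<Sum>i\<le>d. (?K i * X i) $$ (u, v))" for X :: "nat \<Rightarrow> complex mat"
  define T where "T X = (\<Sum>i\<le>d. \<theta> ^ i * (X i * H) $$ (u, v))" for X :: "nat \<Rightarrow> complex mat"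
  have X_index: "X i $$ (p, q) = X' i $$ (p, q) + D i $$ (p, q)" if "i \<le> d" "p < n" "q < m" for i p q
    using split[OF that(1)] X'[OF that(1)] D[OF that(1)] that by simp
  have v': "v < m" using v k by simp
  have I: "I X = I X' + I D"
    unfolding I_def using X_index u v' by (simp add: ring_distribs sum.distrib)
  have L: "L X = L X' + L D"
    unfolding L_def sum.distrib[symmetric]
  proof (rule sum.cong[OF refl])
    fix i assume "i \<in> {..d}"
    then have i: "i \<le> d" by simp
    show "(?K i * X i) $$ (u, v) = (?K i * X' i) $$ (u, v) + (?K i * D i) $$ (u, v)"
      unfolding mult_mat_index[OF K X[OF i] u v'] mult_mat_index[OF K X'[OF i] u v']
        mult_mat_index[OF K D[OF i] u v'] sum.distrib[symmetric]
      using X_index[OF i _ v'] by (intro sum.cong) (auto simp: ring_distribs)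
  qed
  have T: "T X = T X' + T D"
    unfolding T_def sum.distrib[symmetric]
  proof (rule sum.cong[OF refl])
    fix i assume "i \<in> {..d}"
    then have i: "i \<le> d" by simp
    have "(X i * H) $$ (u, v) = (X' i * H) $$ (u, v) + (D i * H) $$ (u, v)"
      unfolding mult_mat_index[OF X[OF i] H u v] mult_mat_index[OF X'[OF i] H u v]
        mult_mat_index[OF D[OF i] H u v] sum.distrib[symmetric]
      using X_index[OF i u] by (intro sum.cong) (auto simp: ring_distribs)
    then show "\<theta> ^ i * (X i * H) $$ (u, v) =
        \<theta> ^ i * (X' i * H) $$ (u, v) + \<theta> ^ i * (D i * H) $$ (u, v)"
      by (simp add: ring_distribs)
  qed
  have lhs: "op_B M (\<lambda>t. first_cols k (mat_poly n m d X t)) \<theta> $$ (u, v) = I X + L X"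
    if "\<And>i. i \<le> d \<Longrightarrow> X i \<in> carrier_mat n m" for X
    using u v by (subst op_B_first_cols_mat_poly[of M, OF M0 that k]) (simp_all add: I_def L_def)
  have rhs: "(mat_poly n m d X \<theta> * H) $$ (u, v) = T X"
    if "\<And>i. i \<le> d \<Longrightarrow> X i \<in> carrier_mat n m" for X
    using u v by (subst mat_poly_mult[OF that H]) (simp_all add: T_def mat_poly_def)
  have "I X + L X = T X"
    using eq[of \<theta>] lhs[of X, OF X] rhs[of X, OF X] by simp
  then have "(I X' + L X') - T X' = T D - (I D + L D)"
    unfolding I L T by (simp add: algebra_simps)
  also have "I D = (\<Sum>i<d. \<theta> ^ Suc i / of_nat (Suc i) * D i $$ (u, v))"
    unfolding I_def using top[OF u v] by (simp add: lessThan_Suc_atMost[symmetric])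
  also have "T D - (\<dots> + L D) = (\<Sum>i\<le>d. \<theta> ^ i * ?Y i $$ (u, v))"
    unfolding T_def sum.atMost_shift[of _ d] using u v
    by (simp add: residual_coeff_def ring_distribs L_def[symmetric] del: index_mult_mat(1))
       (simp add: sum_subtractf algebra_simps del: index_mult_mat(1))
  finally have "(I X' + L X') - T X' = (\<Sum>i\<le>d. \<theta> ^ i * ?Y i $$ (u, v))" .
  moreover have "?res $$ (u, v) = (I X' + L X') - T X'"
  proof -
    have "?res $$ (u, v) = op_B M (\<lambda>t. first_cols k (mat_poly n m d X' t)) \<theta> $$ (u, v) -
        (mat_poly n m d X' \<theta> * H) $$ (u, v)"
      using u v H by (intro index_minus_mat(1)) (simp_all add: mat_poly_def)
    then show ?thesis using lhs[of X', OF X'] rhs[of X', OF X'] by simp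
  qed
  ultimately show "?res $$ (u, v) = mat_poly n k d ?Y \<theta> $$ (u, v)"
    using u v by (simp add: mat_poly_def)
qed (use H in \<open>simp_all add: mat_poly_def\<close>)

lemma poly_norm_mat_poly:
  assumes X: "\<And>i. i \<le> N \<Longrightarrow> X i \<in> carrier_mat n m"
  shows "poly_norm (mat_poly n m N X) = sqrt (\<Sum>i\<le>N. \<Sum>j<m. (vec_norm2 (col (X i) j))\<^sup>2)"
proof -
  have "poly_norm (mat_poly n m N X) = sqrt (\<Sum>i\<le>N. (frob_norm (X i))\<^sup>2)"
    by (rule poly_norm_eq[OF _ X]) (simp_all add: mat_poly_def)
  also have "(\<Sum>i\<le>N. (frob_norm (X i))\<^sup>2) = (\<Sum>i\<le>N. \<Sum>j<m. (vec_norm2 (col (X i) j))\<^sup>2)"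
    using X by (intro sum.cong) (auto simp: frob_norm_sq)
  finally show ?thesis .
qed

section \<open>Bounds for the truncation error and the residual\<close>

lemma harm_le_ln: "harm d \<le> euler_mascheroni + ln (real d + 1)"
proof (cases d)
  case 0
  then show ?thesis using euler_mascheroni_pos by (simp add: harm_def)
next
  case (Suc m)
  have "harm (Suc m) - ln (real (m + 2)) + 1 / real (2 * (m + 2)) \<le> euler_mascheroni"
    by (rule euler_mascheroni_lower)
  moreover have "0 \<le> 1 / real (2 * (m + 2))" by simp
  ultimately have "harm (Suc m) \<le> euler_mascheroni + ln (real (m + 2))" by linarith
  then show ?thesis using Suc by (simp add: add.commute)
qed

lemma poly_norm_le_columns:
  assumes X: "\<And>i. i \<le> N \<Longrightarrow> X i \<in> carrier_mat n m"
    and c: "\<And>j. j < m \<Longrightarrow> (\<Sum>i\<le>N. vec_norm2 (col (X i) j)) \<le> c"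
  shows "poly_norm (mat_poly n m N X) \<le> sqrt (real m) * c"
proof (cases "m = 0")
  case True
  then show ?thesis using poly_norm_mat_poly[of N X n m] X by simp
next
  case False
  have "0 \<le> (\<Sum>i\<le>N. vec_norm2 (col (X i) 0))" by (intro sum_nonneg) simp
  also have "\<dots> \<le> c" using False by (intro c) simp
  finally have c0: "0 \<le> c" .
  have "poly_norm (mat_poly n m N X) = sqrt (\<Sum>j<m. \<Sum>i\<le>N. (vec_norm2 (col (X i) j))\<^sup>2)"
    using poly_norm_mat_poly[of N X n m] X by (simp add: sum.swap[of _ "{..N}"])
  also have "\<dots> \<le> sqrt (\<Sum>j<m. c\<^sup>2)"
  proof (intro real_sqrt_le_mono sum_mono)
    fix j assume "j \<in> {..<m}"
    then have "L2_set (\<lambda>i. vec_norm2 (col (X i) j)) {..N} \<le> c"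
      using c[of j] L2_set_le_sum[of "{..N}" "\<lambda>i. vec_norm2 (col (X i) j)"] by simp
    then show "(\<Sum>i\<le>N. (vec_norm2 (col (X i) j))\<^sup>2) \<le> c\<^sup>2"
      unfolding L2_set_def by (rule sqrt_le_D)
  qed
  also have "\<dots> = sqrt (real m) * c"
    using c0 by (simp add: real_sqrt_mult)
  finally show ?thesis .
qed

text \<open>In one column of the residual, the integral contributes at most \<open>\<sigma> harm d\<close> and the product with
  \<open>H\<close> at most \<open>\<sigma> \<parallel>H\<parallel>\<close> in each of the \<open>d + 1\<close> degrees, while the constant term of \<open>B\<close> is
  left for a separate estimate. It is the vanishing of column \<open>j\<close> of \<open>D d\<close> that ends the harmonic sum at
  \<open>d\<close> instead of \<open>d + 1\<close>: the larger sum \<open>harm (d + 1)\<close> exceeds \<open>\<gamma> + ln (d + 1)\<close>.\<close>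

lemma residual_column_le:
  assumes D: "\<And>i. i \<le> d \<Longrightarrow> D i \<in> carrier_mat n m" and H: "H \<in> carrier_mat m k"
    and K: "\<And>i. K i \<in> carrier_mat n n" and k: "k \<le> m" and j: "j < k" and \<sigma>: "0 \<le> \<sigma>"
    and bound: "\<And>i v. i \<le> d \<Longrightarrow> v \<in> carrier_vec m \<Longrightarrow> vec_norm2 (D i *\<^sub>v v) \<le> \<sigma> * vec_norm2 v"
    and top: "\<And>u. u < n \<Longrightarrow> D d $$ (u, j) = 0"
  shows "(\<Sum>i\<le>d. vec_norm2 (col (residual_coeff n k d K H D i) j)) \<le>
    (harm d + (real d + 1) * spectral_norm H) * \<sigma> + (\<Sum>i<d. vec_norm2 (K i *\<^sub>v col (D i) j))"
proof -
  let ?Y = "residual_coeff n k d K H D"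
  define x where "x i = col (D i) j" for i
  have jm: "j < m" using j k by simp
  have x: "x i \<in> carrier_vec n" if "i \<le> d" for i
    unfolding x_def using D[OF that] by (intro carrier_vecI) simp
  have x_le: "vec_norm2 (x i) \<le> \<sigma>" if "i \<le> d" for i
    using bound[OF that, of "unit_vec m j"] mult_mat_unit_vec[OF D[OF that] jm] jm
    by (simp add: x_def)
  have h: "col H j \<in> carrier_vec m" using H by (intro carrier_vecI) simp
  have Dh: "D i *\<^sub>v col H j \<in> carrier_vec n" if "i \<le> d" for i
    by (rule mult_mat_vec_carrier[OF D[OF that] h])
  have Dh_le: "vec_norm2 (D i *\<^sub>v col H j) \<le> \<sigma> * spectral_norm H" if "i \<le> d" for i
  proof -
    have "vec_norm2 (D i *\<^sub>v col H j) \<le> \<sigma> * vec_norm2 (col H j)" by (rule bound[OF that h])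
    also have "\<dots> \<le> \<sigma> * spectral_norm H"
      using \<sigma> H j by (intro mult_left_mono vec_norm2_col_le_spectral_norm) auto
    finally show ?thesis .
  qed
  have DH_index: "(D i * H) $$ (u, j) = (D i *\<^sub>v col H j) $ u" if "i \<le> d" "u < n" for i u
    using D[OF that(1)] H j that by simp
  have Kx: "K i *\<^sub>v x i \<in> carrier_vec n" if "i \<le> d" for i
    by (rule mult_mat_vec_carrier[OF K x[OF that]])
  have KD_index: "(K i * D i) $$ (u, j) = (K i *\<^sub>v x i) $ u" if "i \<le> d" "u < n" for i u
    using D[OF that(1)] K[of i] jm that by (simp add: x_def)
  have x_top: "x d = 0\<^sub>v n"
    using D[of d] top jm by (intro eq_vecI) (auto simp: x_def)
  have K_top: "K d *\<^sub>v x d = 0\<^sub>v n"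
    using K[of d] unfolding x_top by (intro eq_vecI) auto

  let ?S = "vec n (\<lambda>u. \<Sum>i\<le>d. (K i *\<^sub>v x i) $ u)"
  have "col (?Y 0) j = D 0 *\<^sub>v col H j - ?S"
    using j DH_index KD_index Dh[of 0]
    by (intro eq_vecI) (auto simp: residual_coeff_def simp del: index_mult_mat(1) index_mult_mat_vec)
  then have "vec_norm2 (col (?Y 0) j) \<le> vec_norm2 (D 0 *\<^sub>v col H j) + vec_norm2 ?S"
    using vec_norm2_diff_le[OF Dh, of 0 ?S] by simp
  also have "vec_norm2 ?S \<le> (\<Sum>i\<le>d. vec_norm2 (vec n (\<lambda>u. (K i *\<^sub>v x i) $ u)))"
    by (rule vec_norm2_sum_le) simp
  also have "\<dots> = (\<Sum>i\<le>d. vec_norm2 (K i *\<^sub>v x i))"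
  proof (rule sum.cong[OF refl])
    fix i assume "i \<in> {..d}"
    then have "vec n (\<lambda>u. (K i *\<^sub>v x i) $ u) = K i *\<^sub>v x i"
      using carrier_vecD[OF Kx[of i]] by (intro eq_vecI) (auto simp del: index_mult_mat_vec)
    then show "vec_norm2 (vec n (\<lambda>u. (K i *\<^sub>v x i) $ u)) = vec_norm2 (K i *\<^sub>v x i)" by simp
  qed
  also have "\<dots> = (\<Sum>i<d. vec_norm2 (K i *\<^sub>v x i))"
    by (simp add: lessThan_Suc_atMost[symmetric] K_top)
  finally have Y0: "vec_norm2 (col (?Y 0) j) \<le> \<sigma> * spectral_norm H + (\<Sum>i<d. vec_norm2 (K i *\<^sub>v x i))"
    using Dh_le[of 0] by simp

  have YS: "vec_norm2 (col (?Y (Suc i)) j) \<le> \<sigma> * spectral_norm H + \<sigma> * inverse (real (Suc i))"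
    if i: "i < d" for i
  proof -
    let ?c = "1 / complex_of_nat (Suc i)"
    have "col (?Y (Suc i)) j = D (Suc i) *\<^sub>v col H j - ?c \<cdot>\<^sub>v x i"
      using j jm i DH_index[of "Suc i"] D[of i] x[of i]
      by (intro eq_vecI)
        (auto simp: residual_coeff_def x_def simp del: index_mult_mat(1) index_mult_mat_vec of_nat_Suc)
    then have "vec_norm2 (col (?Y (Suc i)) j) \<le>
        vec_norm2 (D (Suc i) *\<^sub>v col H j) + cmod ?c * vec_norm2 (x i)"
      using vec_norm2_diff_le[OF Dh, of "Suc i" "?c \<cdot>\<^sub>v x i"] i x[of i]
      by (simp add: vec_norm2_smult del: of_nat_Suc)
    also have "cmod ?c = inverse (real (Suc i))"
      by (simp add: norm_divide inverse_eq_divide del: of_nat_Suc)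
    also have "inverse (real (Suc i)) * vec_norm2 (x i) \<le> inverse (real (Suc i)) * \<sigma>"
      using x_le[of i] i by (intro mult_left_mono) auto
    finally show ?thesis
      using Dh_le[of "Suc i"] i by (simp add: mult.commute)
  qed
  have "(\<Sum>i\<le>d. vec_norm2 (col (?Y i) j)) =
      vec_norm2 (col (?Y 0) j) + (\<Sum>i<d. vec_norm2 (col (?Y (Suc i)) j))"
    by (rule sum.atMost_shift)
  also have "\<dots> \<le> (\<sigma> * spectral_norm H + (\<Sum>i<d. vec_norm2 (K i *\<^sub>v x i))) +
      (\<Sum>i<d. \<sigma> * spectral_norm H + \<sigma> * inverse (real (Suc i)))"
    using Y0 YS by (intro add_mono sum_mono) auto
  also have "(\<Sum>i<d. \<sigma> * spectral_norm H + \<sigma> * inverse (real (Suc i))) =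
      real d * (\<sigma> * spectral_norm H) + \<sigma> * harm d"
    by (simp add: sum.distrib harm_altdef sum_distrib_left)
  finally show ?thesis by (simp add: x_def algebra_simps)
qed

text \<open>The factor \<open>x i\<close> obeys two bounds. The uniform one is used for \<open>i < s\<close>, where it costs the
  factor \<open>harm s\<close>. From \<open>i = s\<close> on, the Cauchy bound on \<open>m\<close> turns the factorial decay of \<open>x i\<close>
  into the geometric decay \<open>S C / R\<^sup>i\<^sup>+\<^sup>1\<close>, and \<open>s\<close> is so large that these \<open>d - s\<close> terms
  amount to no more than \<open>S \<sigma>\<close>.\<close>

lemma weighted_sum_split_le:
  fixes m x :: "nat \<Rightarrow> real"
  assumes x: "\<And>i. i < d \<Longrightarrow> 0 \<le> x i" "\<And>i. i < d \<Longrightarrow> x i \<le> \<sigma>" "\<And>i. i < d \<Longrightarrow> x i \<le> C / fact i"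
    and m: "\<And>i. 0 \<le> m i" "\<And>i. i < s \<Longrightarrow> m (Suc i) \<le> \<mu>" "\<And>i. m i \<le> fact i * S / R ^ i"
    and nonneg: "0 \<le> \<mu>" "0 \<le> S" "0 \<le> \<sigma>" and R: "1 < R"
    and s: "C * (real d - real s) / R ^ s \<le> \<sigma>"
  shows "(\<Sum>i<d. m (Suc i) / real (Suc i) * x i) \<le>
    ((euler_mascheroni + ln (real s + 1)) * \<mu> + S) * \<sigma>"
proof -
  have head: "m (Suc i) / real (Suc i) * x i \<le> \<mu> * \<sigma> * inverse (real (Suc i))" if "i < d" "i < s" for i
  proof -
    have "m (Suc i) * x i \<le> \<mu> * \<sigma>"
      using x(1,2)[OF that(1)] m(2)[OF that(2)] nonneg by (intro mult_mono) auto
    then have "m (Suc i) * x i * inverse (real (Suc i)) \<le> \<mu> * \<sigma> * inverse (real (Suc i))"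
      by (intro mult_right_mono) auto
    then show ?thesis by (simp add: divide_inverse mult_ac)
  qed
  have tail: "m (Suc i) / real (Suc i) * x i \<le> S * (C / R ^ s)" if i: "i < d" "s \<le> i" for i
  proof -
    have "0 \<le> C / fact i" using x(1,3)[OF i(1)] by linarith
    from mult_nonneg_nonneg[OF this fact_ge_zero[of i]] have C: "0 \<le> C" by simp
    have "m (Suc i) / real (Suc i) * x i \<le> fact (Suc i) * S / R ^ Suc i / real (Suc i) * (C / fact i)"
      using x(1,3)[OF i(1)] m(1)[of "Suc i"] m(3)[of "Suc i"] nonneg R
      by (intro mult_mono divide_right_mono) auto
    also have "\<dots> = S * (C / R ^ Suc i)"
      by (simp add: field_simps del: of_nat_Suc)
    also have "\<dots> \<le> S * (C / R ^ s)"
      using R C nonneg i by (intro mult_left_mono divide_left_mono power_increasing) auto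
    finally show ?thesis .
  qed
  have harm_s: "\<mu> * \<sigma> * harm e \<le> (euler_mascheroni + ln (real s + 1)) * \<mu> * \<sigma>" if "e \<le> s" for e
  proof -
    have "harm e \<le> euler_mascheroni + ln (real s + 1)"
      using harm_mono[OF that, where 'a = real] harm_le_ln[of s] by linarith
    then have "\<mu> * \<sigma> * harm e \<le> \<mu> * \<sigma> * (euler_mascheroni + ln (real s + 1))"
      using nonneg by (intro mult_left_mono) auto
    then show ?thesis by (simp add: mult_ac)
  qed
  have sum_head: "(\<Sum>i<e. m (Suc i) / real (Suc i) * x i) \<le> \<mu> * \<sigma> * harm e" if "e \<le> d" "e \<le> s" for e
    unfolding harm_altdef sum_distrib_left using head that by (intro sum_mono) auto
  show ?thesis
  proof (cases "d \<le> s")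
    case True
    then show ?thesis
      using sum_head[of d] harm_s[of d] mult_nonneg_nonneg[OF nonneg(2,3)] by (simp add: ring_distribs)
  next
    case False
    then have sd: "s < d" by simp
    have "(\<Sum>i<d. m (Suc i) / real (Suc i) * x i) =
        (\<Sum>i<s. m (Suc i) / real (Suc i) * x i) + (\<Sum>i = s..<d. m (Suc i) / real (Suc i) * x i)"
      using sd by (simp add: lessThan_atLeast0 sum.atLeastLessThan_concat del: of_nat_Suc)
    also have "(\<Sum>i = s..<d. m (Suc i) / real (Suc i) * x i) \<le> (\<Sum>i = s..<d. S * (C / R ^ s))"
      using tail by (intro sum_mono) auto
    also have "\<dots> = S * (C * (real d - real s) / R ^ s)"
      using sd by (simp add: of_nat_diff)
    also have "\<dots> \<le> S * \<sigma>"
      using s nonneg by (intro mult_left_mono)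
    finally show ?thesis
      using sum_head[of s] harm_s[of s] sd by (simp add: ring_distribs)
  qed
qed

lemma mat_inv_carrier:
  assumes M: "M \<in> carrier_mat n n" and inv: "invertible_mat M"
  shows "mat_inv M \<in> carrier_mat n n"
proof (cases "mat_inverse M")
  case None
  obtain B where B: "M * B = 1\<^sub>m n" "B * M = 1\<^sub>m (dim_row B)"
    using inv M by (auto simp: invertible_mat_def inverts_mat_def)
  have "dim_col (M * B) = n" "dim_col (B * M) = dim_row B" unfolding B by simp_all
  then have "B \<in> carrier_mat n n" using M by auto
  with B M have "M \<in> Units (ring_mat TYPE(complex) n ())"
    by (auto simp: Units_def ring_mat_def)
  with mat_inverse(1)[OF M None, where b = "()"] show ?thesis by blast
next
  case (Some B)
  then show ?thesis using mat_inverse(2)[OF M Some] by (simp add: mat_inv_def)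
qed

theorem theorem12:
  fixes M :: "complex \<Rightarrow> complex mat"
    and n d k r r1 s :: nat
    and \<rho> R C C_d C_s :: real
    and a a' :: tensor3
    and Z Z' H A U1 U \<Sigma>1 \<Sigma> :: "complex mat"
    and Ai V A' :: "nat \<Rightarrow> complex mat"
    and \<sigma> :: "nat \<Rightarrow> real"
    and \<Psi> \<Psi>' :: "complex \<Rightarrow> complex mat"
  assumes M_dim: "\<And>\<mu>. \<mu> \<in> ball 0 \<rho> \<Longrightarrow> M \<mu> \<in> carrier_mat n n"
    and M_analytic: "\<And>p q. p < n \<Longrightarrow> q < n \<Longrightarrow> (\<lambda>\<mu>. M \<mu> $$ (p, q)) analytic_on ball 0 \<rho>"
    and M0_inv: "invertible_mat (M 0)"
    and Z_dim: "Z \<in> carrier_mat n r"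
    and Z_orth: "orthonormal_cols Z"
    and \<Psi>: "\<Psi> = tensor_fun d (k + 1) a Z"
    and tiar: "tiar_factorization M k \<Psi> H"
    and C: "\<And>i. i \<le> d \<Longrightarrow> spectral_norm (slice1 (k + 1) r a i) \<le> C / fact i"
    and R: "cball 0 R \<subseteq> ball (0::complex) \<rho>" "R > 1"
    and Ai: "\<And>i. Ai i = transpose_mat (slice1 (k + 1) r a i)"
    and A: "A = hblocks r (map Ai [0..<d + 1])"
    and r1: "1 \<le> r1" "r1 < r"
    and U_dim: "U1 \<in> carrier_mat r r1" "U \<in> carrier_mat r (r - r1)"
    and U_unitary: "unitary_mat (hblocks r [U1, U])"
    and V_dim: "\<And>i. i \<le> d \<Longrightarrow> V i \<in> carrier_mat (k + 1) r"
    and V_orth: "orthonormal_rows (hblocks r (map (\<lambda>i. mat_adjoint (V i)) [0..<d + 1]))"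
    and \<Sigma>1: "\<Sigma>1 = mat_diag r1 (\<lambda>i. complex_of_real (\<sigma> i))"
    and \<Sigma>: "\<Sigma> = mat_diag (r - r1) (\<lambda>i. complex_of_real (\<sigma> (r1 + i)))"
    and \<sigma>_decr: "\<And>i j. i \<le> j \<Longrightarrow> j < r \<Longrightarrow> \<sigma> j \<le> \<sigma> i"
    and \<sigma>_nonneg: "\<And>i. i < r \<Longrightarrow> 0 \<le> \<sigma> i"
    and svd: "A = hblocks r [U1, U] * diag_block_mat [\<Sigma>1, \<Sigma>] *
                  hblocks r (map (\<lambda>i. mat_adjoint (V i)) [0..<d + 1])"
    and Z': "Z' = Z * U1"
    and A': "\<And>i. i \<le> d \<Longrightarrow> A' i = \<Sigma>1 * first_rows r1 (mat_adjoint (V i))"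
    and a': "\<And>i. i \<le> d \<Longrightarrow> slice1 (k + 1) r1 a' i = transpose_mat (A' i)"
    and \<Psi>': "\<Psi>' = tensor_fun d (k + 1) a' Z'"
    and s: "s = (LEAST t. 1 \<le> t \<and> C * (real d - real t) / R ^ t \<le> \<sigma> r1)"
    and C_d: "C_d = euler_mascheroni + ln (real d + 1) + (real d + 1) * spectral_norm H"
    and C_s: "C_s = spectral_norm (mat_inv (M 0)) *
                ((euler_mascheroni + ln (real s + 1)) * Max ((\<lambda>i. spectral_norm (mat_deriv i M 0)) ` {1..s})
                 + Sup ((\<lambda>\<mu>. spectral_norm (M \<mu>)) ` sphere 0 R))"
  shows "poly_norm (\<lambda>\<theta>. \<Psi> \<theta> - \<Psi>' \<theta>) \<le> sqrt ((real d + 1) * (real k + 1)) * \<sigma> r1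
       \<and> poly_norm (\<lambda>\<theta>. op_B M (\<lambda>t. first_cols k (\<Psi>' t)) \<theta> - \<Psi>' \<theta> * H)
           \<le> sqrt (real k) * (C_d + C_s) * \<sigma> r1"
proof -
  have m: "k \<le> k + 1" by simp
  have R0: "0 < R" using R(2) by simp
  have \<rho>: "0 \<in> ball (0::complex) \<rho>" using R0 by (intro subsetD[OF R(1)]) simp
  have \<rho>0: "0 < \<rho>" using \<rho> by simp
  have M0: "M 0 \<in> carrier_mat n n" by (rule M_dim[OF \<rho>])
  have hol: "(\<lambda>\<mu>. M \<mu> $$ (p, q)) holomorphic_on ball 0 \<rho>" if "p < n" "q < n" for p q
    by (rule analytic_imp_holomorphic[OF M_analytic[OF that]])
  have H: "H \<in> carrier_mat (k + 1) k"
    and factorization: "\<And>\<theta>. op_B M (\<lambda>t. first_cols k (\<Psi> t)) \<theta> = \<Psi> \<theta> * H"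
    using tiar by (auto simp: tiar_factorization_def)
  have \<sigma>0: "0 \<le> \<sigma> r1" using \<sigma>_nonneg r1 by simp

  have Ai_dim: "Ai i \<in> carrier_mat r (k + 1)" for i by (simp add: Ai slice1_def)
  have A'_dim: "A' i \<in> carrier_mat r1 (k + 1)" if "i \<le> d" for i
    using V_dim[OF that] unfolding A'[OF that] \<Sigma>1
    by (intro mult_carrier_mat[of _ r1 r1]) (auto simp: first_rows_def)
  have Z'_dim: "Z' \<in> carrier_mat n r1" unfolding Z' by (rule mult_carrier_mat[OF Z_dim U_dim(1)])
  have "\<exists>N. N \<in> carrier_mat r (k + 1) \<and> Ai i = U1 * A' i + N \<and>
      (\<forall>v. v \<in> carrier_vec (k + 1) \<longrightarrow> vec_norm2 (N *\<^sub>v v) \<le> \<sigma> r1 * vec_norm2 v) \<and>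
      (\<forall>v. v \<in> carrier_vec (k + 1) \<longrightarrow> vec_norm2 (N *\<^sub>v v) \<le> vec_norm2 (Ai i *\<^sub>v v))"
    if i: "i \<le> d" for i
    by (rule truncated_svd_block[where V = V and Ai = Ai and A' = A' and \<sigma> = \<sigma> and d = d and i = i,
          OF U_dim r1(2) U_unitary _ V_orth _ _ _ svd[unfolded A \<Sigma>1 \<Sigma>] A'[OF i, unfolded \<Sigma>1] i])
      (use V_dim \<sigma>_decr \<sigma>_nonneg Ai_dim in blast)+
  then obtain N where N: "\<And>i. i \<le> d \<Longrightarrow> N i \<in> carrier_mat r (k + 1)"
      "\<And>i. i \<le> d \<Longrightarrow> Ai i = U1 * A' i + N i"
    and N_le: "\<And>i v. i \<le> d \<Longrightarrow> v \<in> carrier_vec (k + 1) \<Longrightarrow> vec_norm2 (N i *\<^sub>v v) \<le> \<sigma> r1 * vec_norm2 v"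
      "\<And>i v. i \<le> d \<Longrightarrow> v \<in> carrier_vec (k + 1) \<Longrightarrow> vec_norm2 (N i *\<^sub>v v) \<le> vec_norm2 (Ai i *\<^sub>v v)"
    by metis

  define X where "X i = Z * Ai i" for i
  define X' where "X' i = Z' * A' i" for i
  define D where "D i = Z * N i" for i
  have X: "X i \<in> carrier_mat n (k + 1)" for i
    unfolding X_def by (rule mult_carrier_mat[OF Z_dim Ai_dim])
  have X': "X' i \<in> carrier_mat n (k + 1)" if "i \<le> d" for i
    unfolding X'_def by (rule mult_carrier_mat[OF Z'_dim A'_dim[OF that]])
  have D: "D i \<in> carrier_mat n (k + 1)" if "i \<le> d" for i
    unfolding D_def by (rule mult_carrier_mat[OF Z_dim N(1)[OF that]])
  have split: "X i = X' i + D i" if i: "i \<le> d" for i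
  proof -
    have "X i = Z * (U1 * A' i) + Z * N i"
      unfolding X_def N(2)[OF i]
      by (rule mult_add_distrib_mat[OF Z_dim mult_carrier_mat[OF U_dim(1) A'_dim[OF i]] N(1)[OF i]])
    also have "Z * (U1 * A' i) = X' i"
      unfolding X'_def Z' by (rule assoc_mult_mat[OF Z_dim U_dim(1) A'_dim[OF i], symmetric])
    finally show ?thesis by (simp add: D_def)
  qed
  have \<Psi>_poly: "\<Psi> = mat_poly n (k + 1) d X"
    unfolding \<Psi> X_def using Ai_dim
    by (intro tensor_fun_eq_mat_poly[OF Z_dim]) (auto simp: Ai slice1_def)
  have \<Psi>'_poly: "\<Psi>' = mat_poly n (k + 1) d X'"
    unfolding \<Psi>' X'_def
  proof (rule tensor_fun_eq_mat_poly[OF Z'_dim A'_dim])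
    fix i j l assume i: "i \<le> d" and jl: "j < k + 1" "l < r1"
    have "a' i j l = slice1 (k + 1) r1 a' i $$ (j, l)" using jl by (simp add: slice1_def)
    also have "\<dots> = A' i $$ (l, j)" unfolding a'[OF i] using jl A'_dim[OF i] by simp
    finally show "a' i j l = A' i $$ (l, j)" .
  qed

  have D_vec: "vec_norm2 (D i *\<^sub>v v) = vec_norm2 (N i *\<^sub>v v)"
    if i: "i \<le> d" and v: "v \<in> carrier_vec (k + 1)" for i v
    unfolding D_def assoc_mult_mat_vec[OF Z_dim N(1)[OF i] v]
    by (rule vec_norm2_isometry[OF Z_dim Z_orth mult_mat_vec_carrier[OF N(1)[OF i] v]])
  have D_le: "vec_norm2 (D i *\<^sub>v v) \<le> \<sigma> r1 * vec_norm2 v"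
    if "i \<le> d" "v \<in> carrier_vec (k + 1)" for i v
    using N_le(1)[OF that] D_vec[OF that] by simp
  have col_D_le: "vec_norm2 (col (D i) j) \<le> \<sigma> r1"
    "vec_norm2 (col (D i) j) \<le> vec_norm2 (col (Ai i) j)" if i: "i \<le> d" and j: "j < k + 1" for i j
    using D_le[OF i, of "unit_vec (k + 1) j"] D_vec[OF i, of "unit_vec (k + 1) j"]
      N_le(2)[OF i, of "unit_vec (k + 1) j"] mult_mat_unit_vec[OF D[OF i] j]
      mult_mat_unit_vec[OF Ai_dim j, of i] j
    by simp_all
  have col_D_le_C: "vec_norm2 (col (D i) j) \<le> C / fact i" if i: "i \<le> d" and j: "j < k + 1" for i j
  proof -
    have "col (Ai i) j = row (slice1 (k + 1) r a i) j"
      using j by (simp add: Ai slice1_def)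
    then have "vec_norm2 (col (Ai i) j) \<le> spectral_norm (slice1 (k + 1) r a i)"
      using vec_norm2_row_le_spectral_norm[of j "slice1 (k + 1) r a i"] j by (simp add: slice1_def)
    then show ?thesis using col_D_le(2)[OF i j] C[OF i] by linarith
  qed

  have "poly_norm (\<lambda>\<theta>. \<Psi> \<theta> - \<Psi>' \<theta>) \<le> sqrt ((real d + 1) * (real k + 1)) * \<sigma> r1"
  proof -
    have "(\<lambda>\<theta>. \<Psi> \<theta> - \<Psi>' \<theta>) = mat_poly n (k + 1) d D"
    proof
      fix \<theta>
      have "X i $$ (u, v) = X' i $$ (u, v) + D i $$ (u, v)" if "i \<le> d" "u < n" "v < k + 1" for i u v
        using split[OF that(1)] D[OF that(1)] X'[OF that(1)] that by simp
      then show "\<Psi> \<theta> - \<Psi>' \<theta> = mat_poly n (k + 1) d D \<theta>"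
        unfolding \<Psi>_poly \<Psi>'_poly
        by (intro eq_matI) (auto simp: mat_poly_def ring_distribs sum.distrib)
    qed
    then have "poly_norm (\<lambda>\<theta>. \<Psi> \<theta> - \<Psi>' \<theta>) = sqrt (\<Sum>i\<le>d. \<Sum>j<k + 1. (vec_norm2 (col (D i) j))\<^sup>2)"
      using poly_norm_mat_poly[of d D n "k + 1"] D by simp
    also have "\<dots> \<le> sqrt (\<Sum>i\<le>d. \<Sum>j<k + 1. (\<sigma> r1)\<^sup>2)"
      using col_D_le(1) by (intro real_sqrt_le_mono sum_mono power_mono) auto
    also have "\<dots> = sqrt ((real d + 1) * (real k + 1) * (\<sigma> r1)\<^sup>2)"
      by (simp add: algebra_simps)
    also have "\<dots> = sqrt ((real d + 1) * (real k + 1)) * \<sigma> r1"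
      using \<sigma>0 by (simp add: real_sqrt_mult)
    finally show ?thesis .
  qed
  moreover have "poly_norm (\<lambda>\<theta>. op_B M (\<lambda>t. first_cols k (\<Psi>' t)) \<theta> - \<Psi>' \<theta> * H)
      \<le> sqrt (real k) * ((C_d + C_s) * \<sigma> r1)"
  proof -
    let ?K = "\<lambda>i. mat_deriv i (B_fun M) 0"
    let ?W = "mat_inv (M 0)"
    let ?S = "Sup ((\<lambda>\<mu>. spectral_norm (M \<mu>)) ` sphere 0 R)"
    let ?max = "Max ((\<lambda>i. spectral_norm (mat_deriv i M 0)) ` {1..s})"
    have K: "?K i \<in> carrier_mat n n" for i using M0 by (auto simp: mat_deriv_def B_fun_def)
    have W: "?W \<in> carrier_mat n n" by (rule mat_inv_carrier[OF M0 M0_inv])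
    have Mi: "mat_deriv i M 0 \<in> carrier_mat n n" for i using M0 by (auto simp: mat_deriv_def)

    have K_eq: "?K i = (- 1 / complex_of_nat (Suc i)) \<cdot>\<^sub>m (?W * mat_deriv (Suc i) M 0)" for i
      by (rule mat_deriv_B_fun[OF \<rho>0 M_dim hol W])

    have eq: "op_B M (\<lambda>t. first_cols k (mat_poly n (k + 1) d X t)) \<theta> = mat_poly n (k + 1) d X \<theta> * H" for \<theta>
      using factorization unfolding \<Psi>_poly .
    \<comment> \<open>\<open>X d = Z A\<^sub>d\<close> vanishes in the first \<open>k\<close> columns, hence so does \<open>A\<^sub>d\<close>, as \<open>Z\<close> is an isometry, and
      \<open>D d\<close> is dominated by \<open>A\<^sub>d\<close> column by column.\<close>
    have top: "D d $$ (u, v) = 0" if u: "u < n" and v: "v < k" for u v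
    proof -
      have Av: "col (Ai d) v \<in> carrier_vec r" using Ai_dim[of d] by (intro carrier_vecI) simp
      have "col (X d) v = 0\<^sub>v n"
        using top_coeff_zero[of M, OF M0 X m H eq] v X[of d] by (intro eq_vecI) auto
      moreover have "col (X d) v = Z *\<^sub>v col (Ai d) v"
        unfolding X_def using v by (intro col_mult2[OF Z_dim Ai_dim]) simp
      ultimately have "vec_norm2 (col (Ai d) v) = 0"
        using vec_norm2_isometry[OF Z_dim Z_orth Av] by simp
      then have "vec_norm2 (col (D d) v) \<le> 0"
        using col_D_le(2)[of d v] v by simp
      moreover have "cmod (col (D d) v $ u) \<le> vec_norm2 (col (D d) v)"
        using D[of d] u by (intro cmod_index_le_vec_norm2) simp
      ultimately have "cmod (col (D d) v $ u) \<le> 0" by linarith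
      then have "col (D d) v $ u = 0" by simp
      then show ?thesis using D[of d] u v by simp
    qed

    \<comment> \<open>The set that defines \<open>s\<close> contains \<open>max 1 d\<close>, for which \<open>d - t \<le> 0\<close>.\<close>
    have "1 \<le> s \<and> C * (real d - real s) / R ^ s \<le> \<sigma> r1"
    proof -
      have "0 \<le> C"
        using order_trans[OF spectral_norm_nonneg C[of 0]] by simp
      then have "C * (real d - real (max 1 d)) / R ^ max 1 d \<le> 0"
        using R0 by (intro divide_nonpos_pos mult_nonneg_nonpos) auto
      then show ?thesis
        unfolding s using \<sigma>0
        by (intro LeastI[of "\<lambda>t. 1 \<le> t \<and> C * (real d - real t) / R ^ t \<le> \<sigma> r1" "max 1 d"]) auto
    qed
    then have s1: "1 \<le> s" and sC: "C * (real d - real s) / R ^ s \<le> \<sigma> r1" by auto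
    have max_ge: "spectral_norm (mat_deriv (Suc i) M 0) \<le> ?max" if "i < s" for i
      using that by (intro Max_ge) auto
    have max0: "0 \<le> ?max"
      using order_trans[OF spectral_norm_nonneg max_ge[of 0]] s1 by simp
    have sphere: "sphere 0 R \<subseteq> ball (0::complex) \<rho>" using R(1) by auto
    have "bdd_above ((\<lambda>\<mu>. spectral_norm (M \<mu>)) ` sphere 0 R)"
      using sphere M_dim
      by (intro bdd_above_spectral_norm_image holomorphic_on_imp_continuous_on
          holomorphic_on_subset[OF hol]) auto
    then have S_ge: "spectral_norm (M \<mu>) \<le> ?S" if "\<mu> \<in> sphere 0 R" for \<mu>
      using that by (intro cSUP_upper)
    have S0: "0 \<le> ?S"
      using order_trans[OF spectral_norm_nonneg S_ge[of "complex_of_real R"]] R0 by simp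
    have cauchy: "spectral_norm (mat_deriv i M 0) \<le> fact i * ?S / R ^ i" for i
      by (rule spectral_norm_mat_deriv_le[OF R0 R(1) M_dim hol S_ge])

    have col_bound: "(\<Sum>i\<le>d. vec_norm2 (col (residual_coeff n k d ?K H D i) j)) \<le> (C_d + C_s) * \<sigma> r1"
      if j: "j < k" for j
    proof -
      have Kx: "vec_norm2 (?K i *\<^sub>v col (D i) j) \<le> spectral_norm ?W *
          (spectral_norm (mat_deriv (Suc i) M 0) / real (Suc i) * vec_norm2 (col (D i) j))"
        if i: "i < d" for i
      proof -
        let ?L = "mat_deriv (Suc i) M 0" and ?x = "col (D i) j"
        let ?c = "- 1 / complex_of_nat (Suc i)"
        have x: "?x \<in> carrier_vec n" using D[of i] i by (intro carrier_vecI) simp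
        have Lx: "?L *\<^sub>v ?x \<in> carrier_vec n" by (rule mult_mat_vec_carrier[OF Mi x])
        have WL: "?W * ?L \<in> carrier_mat n n" by (rule mult_carrier_mat[OF W Mi])
        have "?K i *\<^sub>v ?x = ?c \<cdot>\<^sub>v ((?W * ?L) *\<^sub>v ?x)"
          unfolding K_eq by (rule smult_mat_mult_vec[OF WL x])
        also have "(?W * ?L) *\<^sub>v ?x = ?W *\<^sub>v (?L *\<^sub>v ?x)"
          by (rule assoc_mult_mat_vec[OF W Mi x])
        finally have "vec_norm2 (?K i *\<^sub>v ?x) = vec_norm2 (?W *\<^sub>v (?L *\<^sub>v ?x)) / real (Suc i)"
          by (simp add: vec_norm2_smult norm_divide del: of_nat_Suc)
        also have "\<dots> \<le> spectral_norm ?W * (spectral_norm ?L * vec_norm2 ?x) / real (Suc i)"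
          using order_trans[OF vec_norm2_mult_le_spectral_norm[OF W Lx]
              mult_left_mono[OF vec_norm2_mult_le_spectral_norm[OF Mi x] spectral_norm_nonneg]]
          by (intro divide_right_mono) auto
        finally show ?thesis by simp
      qed
      have "(\<Sum>i<d. vec_norm2 (?K i *\<^sub>v col (D i) j)) \<le> spectral_norm ?W *
          (\<Sum>i<d. spectral_norm (mat_deriv (Suc i) M 0) / real (Suc i) * vec_norm2 (col (D i) j))"
        unfolding sum_distrib_left using Kx by (intro sum_mono) auto
      also have "\<dots> \<le> spectral_norm ?W * (((euler_mascheroni + ln (real s + 1)) * ?max + ?S) * \<sigma> r1)"
        using col_D_le(1) col_D_le_C j max_ge cauchy max0 S0 \<sigma>0 R(2) sC
        by (intro mult_left_mono weighted_sum_split_le[where C = C and R = R] spectral_norm_nonneg) auto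
      also have "\<dots> = C_s * \<sigma> r1" by (simp add: C_s mult.assoc)
      finally have const: "(\<Sum>i<d. vec_norm2 (?K i *\<^sub>v col (D i) j)) \<le> C_s * \<sigma> r1" .
      have "(harm d + (real d + 1) * spectral_norm H) * \<sigma> r1 \<le> C_d * \<sigma> r1"
        unfolding C_d using harm_le_ln[of d] \<sigma>0 by (intro mult_right_mono) auto
      moreover have "(\<Sum>i\<le>d. vec_norm2 (col (residual_coeff n k d ?K H D i) j)) \<le>
          (harm d + (real d + 1) * spectral_norm H) * \<sigma> r1 +
          (\<Sum>i<d. vec_norm2 (?K i *\<^sub>v col (D i) j))"
        by (rule residual_column_le[where K = ?K and m = "k + 1", OF _ H K m j \<sigma>0])
          (use D D_le top j in blast)+
      ultimately show ?thesis
        using const by (simp add: ring_distribs)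
    qed
    have "(\<lambda>\<theta>. op_B M (\<lambda>t. first_cols k (\<Psi>' t)) \<theta> - \<Psi>' \<theta> * H) =
        mat_poly n k d (residual_coeff n k d ?K H D)"
      unfolding \<Psi>'_poly
      by (rule ext, rule residual_eq_mat_poly[of M, OF M0 m H X X' D split top eq])
    then show ?thesis
      using col_bound by (simp only:) (intro poly_norm_le_columns, auto simp: residual_coeff_def)
  qed
  ultimately show ?thesis by (simp add: mult.assoc)
qed

end
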